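(* Let $k$ be an algebraically closed field, $\Lambda$ a finite dimensional $k$-algebra, and $I$ an ideal of $\Lambda$ with $I\subset (Z(\Lambda)\cap J(\Lambda))\cdot\Lambda$. Then the Eisele–Janssens–Raedschelders isomorphism of partially ordered sets $\Phi:\mathrm{s}\tau\text{-}\mathrm{tilt}\,\Lambda\to\mathrm{s}\tau\text{-}\mathrm{tilt}\,\Lambda/I$ sends $M\in\mathrm{s}\tau\text{-}\mathrm{tilt}\,\Lambda$ to $M/IM\in\mathrm{s}\tau\text{-}\mathrm{tilt}\,\Lambda/I$.
   Context: All modules are finite dimensional left modules. $Z(\Lambda)$ is the center and $J(\Lambda)$ the Jacobson radical of $\Lambda$; $\Lambda\text{-}\mathrm{mod}$ is the category of finite dimensional left $\Lambda$-modules, $\Lambda\text{-}\mathrm{proj}$ its full subcategory of projective modules, and $K^b(\Lambda\text{-}\mathrm{proj})$ the homotopy category of bounded complexes of finite dimensional projective left $\Lambda$-modules. $|M|$ is the number of nonisomorphic indecomposable direct summands of $M$, and $\tau$ is the Auslander–Reiten translate. A module $M\in\Lambda\text{-}\mathrm{mod}$ is support $\tau$-tilting if $\mathrm{Hom}_\Lambda(M,\tau M)=0$ and there is $P\in\Lambda\text{-}\mathrm{proj}$ with $\mathrm{Hom}_\Lambda(P,M)=0$ and $|P|+|M|=|\Lambda|$; one also writes it as a pair $(M,P)$ with $P$ basic. $\mathrm{s}\tau\text{-}\mathrm{tilt}\,\Lambda$ is the set of isomorphism classes of basic support $\tau$-tilting $\Lambda$-modules, partially ordered by: $M\geq M'$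 iff there is a surjective homomorphism from a finite direct sum of copies of $M$ to $M'$. A complex $T\in K^b(\Lambda\text{-}\mathrm{proj})$ is silting if $\mathrm{Hom}(T,T[i])=0$ for all $i>0$ and $\mathrm{add}\,T$ generates $K^b(\Lambda\text{-}\mathrm{proj})$ as a triangulated category; it is two-term if $T^i=0$ for $i\neq-1,0$. $2\text{-}\mathrm{silt}\,\Lambda$ is the set of isomorphism classes of basic two-term silting complexes, ordered by $T\ge T'$ iff $\mathrm{Hom}(T,T'[i])=0$ for all $i>0$. By Adachi–Iyama–Reiten there is an isomorphism of partially ordered sets $\mathrm{s}\tau\text{-}\mathrm{tilt}\,\Lambda\cong2\text{-}\mathrm{silt}\,\Lambda$ sending $(M,P)$ to $(P_1^M\oplus P\xrightarrow{(f\;0)}P_0^M)$, where $P_1^M\xrightarrow{f}P_0^M\to M\to0$ is the minimal projective presentation of $M$, with inverse sending $(P^{-1}\xrightarrow{g}P^0)$ to $\mathrm{Cok}\,g$. The Eisele–Janssens–Raedschelders isomorphism $\Phi$ (a known result for $I\subset(Z(\Lambda)\cap J(\Lambda))\cdot\Lambda$) is the isomorphism of partially ordered sets $\mathrm{s}\tau\text{-}\mathrm{tilt}\,\Lambda\to\mathrm{s}\tau\text{-}\mathrm{tilt}\,\Lambda/I$ that corresponds, under the Adachi–Iyama–Reiten isomorphisms for $\Lambda$ and $\Lambda/I$, to the isomorphism $2\text{-}\mathrm{silt}\,\Lambda\to2\text{-}\mathrm{silt}\,\Lambda/I$ given by applying $\Lambda/I\otimes_\Lambda-$ to complexes. *)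

theory Defs
  imports
    "HOL-Algebra.Algebraic_Closure"
    "HOL-Algebra.Ideal_Product"
    "HOL-Algebra.QuotRing"
    "HOL-Algebra.Free_Abelian_Groups"
begin

text \<open>
  A \<open>K\<close>-algebra is a \<^const>\<open>carrier\<close>-based structure of type \<open>('k, 'a) module\<close>: the ring fields
  carry the ring structure and \<open>smult\<close> the action of \<open>K\<close>.  A left module over it is a structure of
  type \<open>('a, 'v) module\<close> whose fields \<open>monoid.mult\<close> and \<open>one\<close> are irrelevant, as usual in
  HOL-Algebra.  The library locale \<open>module\<close> requires a commutative base ring and is used for the
  \<open>K\<close>-structure only.

  Quantification over all finite dimensional modules ranges over modules whose carrier is a set of
  \<open>'k\<close>-lists.  Every finite dimensional \<open>K\<close>-space is in bijection with some \<open>K\<^sup>n\<close>, so every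
  isomorphism class is represented there.  Homomorphisms, isomorphisms, sums, cones and so on are
  defined for arbitrary carrier types, and isomorphisms may relate different carrier types.
\<close>

section \<open>Algebras\<close>

definition fd_algebra :: "'k ring \<Rightarrow> ('k, 'a) module \<Rightarrow> bool" where
  "fd_algebra K A \<longleftrightarrow>
     field K \<and> ring A \<and> module K A \<and>
     (\<forall>c\<in>carrier K. \<forall>x\<in>carrier A. \<forall>y\<in>carrier A.
        (c \<odot>\<^bsub>A\<^esub> x) \<otimes>\<^bsub>A\<^esub> y = c \<odot>\<^bsub>A\<^esub> (x \<otimes>\<^bsub>A\<^esub> y) \<and>
        x \<otimes>\<^bsub>A\<^esub> (c \<odot>\<^bsub>A\<^esub> y) = c \<odot>\<^bsub>A\<^esub> (x \<otimes>\<^bsub>A\<^esub> y)) \<and>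
     (\<exists>B. finite B \<and> B \<subseteq> carrier A \<and>
        (\<forall>x\<in>carrier A. \<exists>c\<in>B \<rightarrow> carrier K. x = (\<Oplus>\<^bsub>A\<^esub>b\<in>B. c b \<odot>\<^bsub>A\<^esub> b)))"

definition center :: "('a, 'b) ring_scheme \<Rightarrow> 'a set" where
  "center A = {z \<in> carrier A. \<forall>x\<in>carrier A. z \<otimes>\<^bsub>A\<^esub> x = x \<otimes>\<^bsub>A\<^esub> z}"

definition quot_algebra :: "('k, 'a) module \<Rightarrow> 'a set \<Rightarrow> ('k, 'a set) module" where
  "quot_algebra A I =
     \<lparr>carrier = carrier (A Quot I), monoid.mult = monoid.mult (A Quot I), monoid.one = monoid.one (A Quot I),
      ring.zero = ring.zero (A Quot I), ring.add = ring.add (A Quot I),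
      module.smult = (\<lambda>c U. \<Union>x\<in>U. I +>\<^bsub>A\<^esub> (c \<odot>\<^bsub>A\<^esub> x))\<rparr>"


section \<open>Modules\<close>

definition mk_mod ::
  "'v set \<Rightarrow> 'v \<Rightarrow> ('v \<Rightarrow> 'v \<Rightarrow> 'v) \<Rightarrow> ('a \<Rightarrow> 'v \<Rightarrow> 'v) \<Rightarrow> ('a, 'v) module" where
  "mk_mod C z p s =
     \<lparr>carrier = C, monoid.mult = undefined, monoid.one = undefined, ring.zero = z, ring.add = p, module.smult = s\<rparr>"

locale left_module = R?: ring R + M?: abelian_group M
  for R :: "('a, 'r) ring_scheme" (structure) and M :: "('a, 'v, 'm) module_scheme" (structure) +
  assumes smult_closed:
      "\<lbrakk>a \<in> carrier R; x \<in> carrier M\<rbrakk> \<Longrightarrow> a \<odot>\<^bsub>M\<^esub> x \<in> carrier M"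
    and smult_l_distr:
      "\<lbrakk>a \<in> carrier R; b \<in> carrier R; x \<in> carrier M\<rbrakk> \<Longrightarrow>
       (a \<oplus>\<^bsub>R\<^esub> b) \<odot>\<^bsub>M\<^esub> x = a \<odot>\<^bsub>M\<^esub> x \<oplus>\<^bsub>M\<^esub> b \<odot>\<^bsub>M\<^esub> x"
    and smult_r_distr:
      "\<lbrakk>a \<in> carrier R; x \<in> carrier M; y \<in> carrier M\<rbrakk> \<Longrightarrow>
       a \<odot>\<^bsub>M\<^esub> (x \<oplus>\<^bsub>M\<^esub> y) = a \<odot>\<^bsub>M\<^esub> x \<oplus>\<^bsub>M\<^esub> a \<odot>\<^bsub>M\<^esub> y"
    and smult_assoc1:
      "\<lbrakk>a \<in> carrier R; b \<in> carrier R; x \<in> carrier M\<rbrakk> \<Longrightarrow>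
       (a \<otimes>\<^bsub>R\<^esub> b) \<odot>\<^bsub>M\<^esub> x = a \<odot>\<^bsub>M\<^esub> (b \<odot>\<^bsub>M\<^esub> x)"
    and smult_one:
      "x \<in> carrier M \<Longrightarrow> \<one>\<^bsub>R\<^esub> \<odot>\<^bsub>M\<^esub> x = x"

text \<open>A scalar \<open>c\<close> of \<open>K\<close> acts on an \<open>A\<close>-module as \<open>c \<odot> \<one>\<close> of \<open>A\<close>.\<close>

definition fd_mod :: "'k ring \<Rightarrow> ('k, 'a) module \<Rightarrow> ('a, 'v) module \<Rightarrow> bool" where
  "fd_mod K A M \<longleftrightarrow> left_module A M \<and>
     (\<exists>B. finite B \<and> B \<subseteq> carrier M \<and>
        (\<forall>x\<in>carrier M. \<exists>c\<in>B \<rightarrow> carrier K.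
           x = (\<Oplus>\<^bsub>M\<^esub>b\<in>B. (c b \<odot>\<^bsub>A\<^esub> \<one>\<^bsub>A\<^esub>) \<odot>\<^bsub>M\<^esub> b)))"

definition mod_hom ::
  "('k, 'a) module \<Rightarrow> ('a, 'v) module \<Rightarrow> ('a, 'w) module \<Rightarrow> ('v \<Rightarrow> 'w) set" where
  "mod_hom A M N = {h \<in> carrier M \<rightarrow> carrier N.
     (\<forall>x\<in>carrier M. \<forall>y\<in>carrier M. h (x \<oplus>\<^bsub>M\<^esub> y) = h x \<oplus>\<^bsub>N\<^esub> h y) \<and>
     (\<forall>a\<in>carrier A. \<forall>x\<in>carrier M. h (a \<odot>\<^bsub>M\<^esub> x) = a \<odot>\<^bsub>N\<^esub> h x)}"

definition mod_iso ::
  "('k, 'a) module \<Rightarrow> ('a, 'v) module \<Rightarrow> ('a, 'w) module \<Rightarrow> ('v \<Rightarrow> 'w) set" where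
  "mod_iso A M N = {h \<in> mod_hom A M N. bij_betw h (carrier M) (carrier N)}"

definition isomorphic_mod ::
  "('k, 'a) module \<Rightarrow> ('a, 'v) module \<Rightarrow> ('a, 'w) module \<Rightarrow> bool" where
  "isomorphic_mod A M N \<longleftrightarrow> mod_iso A M N \<noteq> {}"

definition hom_zero ::
  "('k, 'a) module \<Rightarrow> ('a, 'v) module \<Rightarrow> ('a, 'w) module \<Rightarrow> bool" where
  "hom_zero A M N \<longleftrightarrow> (\<forall>h\<in>mod_hom A M N. \<forall>x\<in>carrier M. h x = \<zero>\<^bsub>N\<^esub>)"

definition is_zero :: "('a, 'v) module \<Rightarrow> bool" where
  "is_zero M \<longleftrightarrow> carrier M = {\<zero>\<^bsub>M\<^esub>}"

definition iso_class ::
  "'k ring \<Rightarrow> ('k, 'a) module \<Rightarrow> ('a, 'v) module \<Rightarrow> ('a, 'k list) module set" where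
  "iso_class K A M = {N. fd_mod K A N \<and> isomorphic_mod A M N}"

definition zero_mod :: "('a, 'v) module" where
  "zero_mod = mk_mod {undefined} undefined (\<lambda>_ _. undefined) (\<lambda>_ _. undefined)"

definition regular_mod :: "('k, 'a) module \<Rightarrow> ('a, 'a) module" where
  "regular_mod A = mk_mod (carrier A) \<zero>\<^bsub>A\<^esub> (ring.add A) (monoid.mult A)"

definition mod_sum :: "('a, 'v) module \<Rightarrow> ('a, 'w) module \<Rightarrow> ('a, 'v \<times> 'w) module" where
  "mod_sum M N = mk_mod (carrier M \<times> carrier N) (\<zero>\<^bsub>M\<^esub>, \<zero>\<^bsub>N\<^esub>)
     (\<lambda>(x, y) (x', y'). (x \<oplus>\<^bsub>M\<^esub> x', y \<oplus>\<^bsub>N\<^esub> y'))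
     (\<lambda>a (x, y). (a \<odot>\<^bsub>M\<^esub> x, a \<odot>\<^bsub>N\<^esub> y))"

definition mod_pow :: "nat \<Rightarrow> ('a, 'v) module \<Rightarrow> ('a, nat \<Rightarrow> 'v) module" where
  "mod_pow n M = mk_mod ({..<n} \<rightarrow>\<^sub>E carrier M) (\<lambda>i\<in>{..<n}. \<zero>\<^bsub>M\<^esub>)
     (\<lambda>x y. \<lambda>i\<in>{..<n}. x i \<oplus>\<^bsub>M\<^esub> y i)
     (\<lambda>a x. \<lambda>i\<in>{..<n}. a \<odot>\<^bsub>M\<^esub> x i)"

definition quot_mod :: "('a, 'v) module \<Rightarrow> 'v set \<Rightarrow> ('a, 'v set) module" where
  "quot_mod M N = mk_mod (a_rcosets\<^bsub>M\<^esub> N) N (set_add M)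
     (\<lambda>a U. \<Union>x\<in>U. N +>\<^bsub>M\<^esub> (a \<odot>\<^bsub>M\<^esub> x))"

text \<open>The Jacobson radical is the intersection of the maximal left ideals, that is, of the maximal
  submodules of the regular module.\<close>

definition jacobson_radical :: "('k, 'a) module \<Rightarrow> 'a set" where
  "jacobson_radical A =
     carrier A \<inter>
     \<Inter>{L. submodule L A (regular_mod A) \<and> L \<noteq> carrier A \<and>
          (\<forall>L'. submodule L' A (regular_mod A) \<and> L \<subseteq> L' \<longrightarrow> L' = L \<or> L' = carrier A)}"

definition indecomposable_mod :: "'k ring \<Rightarrow> ('k, 'a) module \<Rightarrow> ('a, 'v) module \<Rightarrow> bool" where
  "indecomposable_mod K A U \<longleftrightarrow> fd_mod K A U \<and> \<not> is_zero U \<and>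
     (\<forall>(Y :: ('a, 'k list) module) (Z :: ('a, 'k list) module).
        fd_mod K A Y \<and> fd_mod K A Z \<and> isomorphic_mod A U (mod_sum Y Z) \<longrightarrow> is_zero Y \<or> is_zero Z)"

definition summand_mod ::
  "'k ring \<Rightarrow> ('k, 'a) module \<Rightarrow> ('a, 'w) module \<Rightarrow> ('a, 'v) module \<Rightarrow> bool" where
  "summand_mod K A U M \<longleftrightarrow>
     (\<exists>Y :: ('a, 'k list) module. fd_mod K A Y \<and> isomorphic_mod A M (mod_sum U Y))"

definition num_summands :: "'k ring \<Rightarrow> ('k, 'a) module \<Rightarrow> ('a, 'v) module \<Rightarrow> nat" where
  "num_summands K A M =
     card {iso_class K A U |U :: ('a, 'k list) module.
             indecomposable_mod K A U \<and> summand_mod K A U M}"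

definition basic_mod :: "'k ring \<Rightarrow> ('k, 'a) module \<Rightarrow> ('a, 'v) module \<Rightarrow> bool" where
  "basic_mod K A M \<longleftrightarrow>
     \<not> (\<exists>U :: ('a, 'k list) module. indecomposable_mod K A U \<and> summand_mod K A (mod_sum U U) M)"

definition projective_mod :: "'k ring \<Rightarrow> ('k, 'a) module \<Rightarrow> ('a, 'v) module \<Rightarrow> bool" where
  "projective_mod K A P \<longleftrightarrow> fd_mod K A P \<and>
     (\<forall>(U :: ('a, 'k list) module) (Y :: ('a, 'k list) module).
        fd_mod K A U \<and> fd_mod K A Y \<longrightarrow>
        (\<forall>g\<in>mod_hom A U Y. \<forall>h\<in>mod_hom A P Y.
           g ` carrier U = carrier Y \<longrightarrow>
           (\<exists>l\<in>mod_hom A P U. \<forall>x\<in>carrier P. g (l x) = h x)))"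


section \<open>Minimal projective presentations and the Auslander--Reiten translate\<close>

text \<open>A projective cover is an epimorphism from a projective module with superfluous kernel.\<close>

definition projective_cover ::
  "'k ring \<Rightarrow> ('k, 'a) module \<Rightarrow> ('a, 'w) module \<Rightarrow> ('w \<Rightarrow> 'v) \<Rightarrow> ('a, 'v) module \<Rightarrow> bool" where
  "projective_cover K A P p M \<longleftrightarrow>
     projective_mod K A P \<and> p \<in> mod_hom A P M \<and> p ` carrier P = carrier M \<and>
     (\<forall>L. submodule L A P \<and> L <+>\<^bsub>P\<^esub> a_kernel P M p = carrier P \<longrightarrow> L = carrier P)"

definition minimal_presentation ::
  "'k ring \<Rightarrow> ('k, 'a) module \<Rightarrow> ('a, 'w) module \<Rightarrow> ('w \<Rightarrow> 'w) \<Rightarrow> ('a, 'w) module \<Rightarrow> ('w \<Rightarrow> 'v)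
    \<Rightarrow> ('a, 'v) module \<Rightarrow> bool" where
  "minimal_presentation K A P1 f P0 p M \<longleftrightarrow>
     projective_cover K A P0 p M \<and>
     projective_cover K A P1 f (P0\<lparr>carrier := a_kernel P0 M p\<rparr>)"

text \<open>\<open>Hom\<^sub>A(P, A)\<close> is a right \<open>A\<close>-module by \<open>(\<phi> a) x = \<phi> x \<otimes> a\<close>.  Right modules are written with
  the scalar in front; they are left modules over the opposite algebra.\<close>

definition hom_regular :: "('k, 'a) module \<Rightarrow> ('a, 'v) module \<Rightarrow> ('a, 'v \<Rightarrow> 'a) module" where
  "hom_regular A P = mk_mod (mod_hom A P (regular_mod A) \<inter> extensional (carrier P))
     (\<lambda>x\<in>carrier P. \<zero>\<^bsub>A\<^esub>)
     (\<lambda>\<phi> \<psi>. \<lambda>x\<in>carrier P. \<phi> x \<oplus>\<^bsub>A\<^esub> \<psi> x)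
     (\<lambda>a \<phi>. \<lambda>x\<in>carrier P. \<phi> x \<otimes>\<^bsub>A\<^esub> a)"

text \<open>The transpose: cokernel of \<open>Hom\<^sub>A(f, A) : Hom\<^sub>A(P\<^sub>0, A) \<rightarrow> Hom\<^sub>A(P\<^sub>1, A)\<close>.\<close>

definition transpose_mod ::
  "('k, 'a) module \<Rightarrow> ('a, 'v) module \<Rightarrow> ('v \<Rightarrow> 'v) \<Rightarrow> ('a, 'v) module
    \<Rightarrow> ('a, ('v \<Rightarrow> 'a) set) module" where
  "transpose_mod A P1 f P0 =
     quot_mod (hom_regular A P1)
       ((\<lambda>\<phi>. \<lambda>x\<in>carrier P1. \<phi> (f x)) ` carrier (hom_regular A P0))"

text \<open>The duality \<open>D = Hom\<^sub>K(-, K)\<close>, from right \<open>A\<close>-modules to left \<open>A\<close>-modules.\<close>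

definition dual_mod ::
  "'k ring \<Rightarrow> ('k, 'a) module \<Rightarrow> ('a, 'w) module \<Rightarrow> ('a, 'w \<Rightarrow> 'k) module" where
  "dual_mod K A U = mk_mod
     {\<xi> \<in> carrier U \<rightarrow>\<^sub>E carrier K.
        (\<forall>x\<in>carrier U. \<forall>y\<in>carrier U. \<xi> (x \<oplus>\<^bsub>U\<^esub> y) = \<xi> x \<oplus>\<^bsub>K\<^esub> \<xi> y) \<and>
        (\<forall>c\<in>carrier K. \<forall>x\<in>carrier U. \<xi> ((c \<odot>\<^bsub>A\<^esub> \<one>\<^bsub>A\<^esub>) \<odot>\<^bsub>U\<^esub> x) = c \<otimes>\<^bsub>K\<^esub> \<xi> x)}
     (\<lambda>x\<in>carrier U. \<zero>\<^bsub>K\<^esub>)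
     (\<lambda>\<xi> \<eta>. \<lambda>x\<in>carrier U. \<xi> x \<oplus>\<^bsub>K\<^esub> \<eta> x)
     (\<lambda>a \<xi>. \<lambda>x\<in>carrier U. \<xi> (a \<odot>\<^bsub>U\<^esub> x))"

text \<open>\<open>\<tau> M = D Tr M\<close>, computed from a chosen minimal projective presentation (which exists and is
  unique up to isomorphism).\<close>

definition ar_translate ::
  "'k ring \<Rightarrow> ('k, 'a) module \<Rightarrow> ('a, 'v) module
    \<Rightarrow> ('a, ('k list \<Rightarrow> 'a) set \<Rightarrow> 'k) module" where
  "ar_translate K A M =
     (let (P1, f, P0) = (SOME (P1, f, P0). \<exists>p. minimal_presentation K A P1 f P0 p M)
      in dual_mod K A (transpose_mod A P1 f P0))"


section \<open>Support \<open>\<tau>\<close>-tilting modules\<close>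

definition support_complement ::
  "'k ring \<Rightarrow> ('k, 'a) module \<Rightarrow> ('a, 'v) module \<Rightarrow> ('a, 'k list) module \<Rightarrow> bool" where
  "support_complement K A M P \<longleftrightarrow>
     projective_mod K A P \<and> hom_zero A P M \<and>
     num_summands K A P + num_summands K A M = num_summands K A (regular_mod A)"

definition support_tau_tilting :: "'k ring \<Rightarrow> ('k, 'a) module \<Rightarrow> ('a, 'v) module \<Rightarrow> bool" where
  "support_tau_tilting K A M \<longleftrightarrow>
     fd_mod K A M \<and> hom_zero A M (ar_translate K A M) \<and> (\<exists>P. support_complement K A M P)"

definition stau_tilt :: "'k ring \<Rightarrow> ('k, 'a) module \<Rightarrow> ('a, 'k list) module set set" where
  "stau_tilt K A =
     {iso_class K A M |M :: ('a, 'k list) module. support_tau_tilting K A M \<and> basic_mod K A M}"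

definition stau_ge ::
  "('k, 'a) module \<Rightarrow> ('a, 'k list) module set \<Rightarrow> ('a, 'k list) module set \<Rightarrow> bool" where
  "stau_ge A U Y \<longleftrightarrow>
     (\<exists>M\<in>U. \<exists>N\<in>Y. \<exists>n. \<exists>h\<in>mod_hom A (mod_pow n M) N. h ` carrier (mod_pow n M) = carrier N)"


section \<open>Complexes and the homotopy category\<close>

record ('a, 'v) cpx =
  obj :: "int \<Rightarrow> ('a, 'v) module"
  dif :: "int \<Rightarrow> 'v \<Rightarrow> 'v"

definition is_complex :: "('k, 'a) module \<Rightarrow> ('a, 'v) cpx \<Rightarrow> bool" where
  "is_complex A U \<longleftrightarrow> (\<forall>n. left_module A (obj U n) \<and>
     dif U n \<in> mod_hom A (obj U n) (obj U (n + 1)) \<and>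
     (\<forall>x\<in>carrier (obj U n). dif U (n + 1) (dif U n x) = \<zero>\<^bsub>obj U (n + 1 + 1)\<^esub>))"

definition bounded_proj_complex ::
  "'k ring \<Rightarrow> ('k, 'a) module \<Rightarrow> ('a, 'v) cpx \<Rightarrow> bool" where
  "bounded_proj_complex K A U \<longleftrightarrow>
     is_complex A U \<and> (\<forall>n. projective_mod K A (obj U n)) \<and>
     (\<exists>N. \<forall>n. N < \<bar>n\<bar> \<longrightarrow> is_zero (obj U n))"

definition chain_maps ::
  "('k, 'a) module \<Rightarrow> ('a, 'v) cpx \<Rightarrow> ('a, 'w) cpx \<Rightarrow> (int \<Rightarrow> 'v \<Rightarrow> 'w) set" where
  "chain_maps A U Y = {f. \<forall>n. f n \<in> mod_hom A (obj U n) (obj Y n) \<and>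
     (\<forall>x\<in>carrier (obj U n). f (n + 1) (dif U n x) = dif Y n (f n x))}"

definition homotopic_maps ::
  "('k, 'a) module \<Rightarrow> ('a, 'v) cpx \<Rightarrow> ('a, 'w) cpx \<Rightarrow> (int \<Rightarrow> 'v \<Rightarrow> 'w) \<Rightarrow> (int \<Rightarrow> 'v \<Rightarrow> 'w) \<Rightarrow> bool"
  where
  "homotopic_maps A U Y f g \<longleftrightarrow>
     (\<exists>h. \<forall>n. h n \<in> mod_hom A (obj U n) (obj Y (n - 1)) \<and>
        (\<forall>x\<in>carrier (obj U n).
           f n x = g n x \<oplus>\<^bsub>obj Y n\<^esub> (dif Y (n - 1) (h n x) \<oplus>\<^bsub>obj Y n\<^esub> h (n + 1) (dif U n x))))"

definition isomorphic_K :: "('k, 'a) module \<Rightarrow> ('a, 'v) cpx \<Rightarrow> ('a, 'w) cpx \<Rightarrow> bool" where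
  "isomorphic_K A U Y \<longleftrightarrow>
     (\<exists>f\<in>chain_maps A U Y. \<exists>g\<in>chain_maps A Y U.
        homotopic_maps A U U (\<lambda>n x. g n (f n x)) (\<lambda>n x. x) \<and>
        homotopic_maps A Y Y (\<lambda>n y. f n (g n y)) (\<lambda>n y. y))"

definition hom_K_zero :: "('k, 'a) module \<Rightarrow> ('a, 'v) cpx \<Rightarrow> ('a, 'w) cpx \<Rightarrow> bool" where
  "hom_K_zero A U Y \<longleftrightarrow>
     (\<forall>f\<in>chain_maps A U Y. homotopic_maps A U Y f (\<lambda>n x. \<zero>\<^bsub>obj Y n\<^esub>))"

definition is_zero_K :: "('k, 'a) module \<Rightarrow> ('a, 'v) cpx \<Rightarrow> bool" where
  "is_zero_K A U \<longleftrightarrow> homotopic_maps A U U (\<lambda>n x. x) (\<lambda>n x. \<zero>\<^bsub>obj U n\<^esub>)"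

definition shift :: "int \<Rightarrow> ('a, 'v) cpx \<Rightarrow> ('a, 'v) cpx" where
  "shift i U =
     \<lparr>obj = (\<lambda>n. obj U (n + i)),
      dif = (\<lambda>n x. if even i then dif U (n + i) x
                    else \<ominus>\<^bsub>obj U (n + i + 1)\<^esub> dif U (n + i) x)\<rparr>"

definition cone :: "('a, 'v) cpx \<Rightarrow> ('a, 'w) cpx \<Rightarrow> (int \<Rightarrow> 'v \<Rightarrow> 'w) \<Rightarrow> ('a, 'v \<times> 'w) cpx" where
  "cone U Y f =
     \<lparr>obj = (\<lambda>n. mod_sum (obj U (n + 1)) (obj Y n)),
      dif = (\<lambda>n (x, y). (\<ominus>\<^bsub>obj U (n + 1 + 1)\<^esub> dif U (n + 1) x,
                          f (n + 1) x \<oplus>\<^bsub>obj Y (n + 1)\<^esub> dif Y n y))\<rparr>"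

definition cpx_sum :: "('a, 'v) cpx \<Rightarrow> ('a, 'w) cpx \<Rightarrow> ('a, 'v \<times> 'w) cpx" where
  "cpx_sum U Y =
     \<lparr>obj = (\<lambda>n. mod_sum (obj U n) (obj Y n)), dif = (\<lambda>n (x, y). (dif U n x, dif Y n y))\<rparr>"

definition cpx_pow :: "nat \<Rightarrow> ('a, 'v) cpx \<Rightarrow> ('a, nat \<Rightarrow> 'v) cpx" where
  "cpx_pow m U =
     \<lparr>obj = (\<lambda>n. mod_pow m (obj U n)), dif = (\<lambda>n x. \<lambda>i\<in>{..<m}. dif U n (x i))\<rparr>"

definition K_class ::
  "'k ring \<Rightarrow> ('k, 'a) module \<Rightarrow> ('a, 'v) cpx \<Rightarrow> ('a, 'k list) cpx set" where
  "K_class K A U = {Y. bounded_proj_complex K A Y \<and> isomorphic_K A U Y}"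

definition summand_K ::
  "'k ring \<Rightarrow> ('k, 'a) module \<Rightarrow> ('a, 'w) cpx \<Rightarrow> ('a, 'v) cpx \<Rightarrow> bool" where
  "summand_K K A U T \<longleftrightarrow>
     (\<exists>Y :: ('a, 'k list) cpx. bounded_proj_complex K A Y \<and> isomorphic_K A T (cpx_sum U Y))"

definition indecomposable_K :: "'k ring \<Rightarrow> ('k, 'a) module \<Rightarrow> ('a, 'v) cpx \<Rightarrow> bool" where
  "indecomposable_K K A U \<longleftrightarrow> bounded_proj_complex K A U \<and> \<not> is_zero_K A U \<and>
     (\<forall>(Y :: ('a, 'k list) cpx) (Z :: ('a, 'k list) cpx).
        bounded_proj_complex K A Y \<and> bounded_proj_complex K A Z \<and> isomorphic_K A U (cpx_sum Y Z)
        \<longrightarrow> is_zero_K A Y \<or> is_zero_K A Z)"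

definition basic_K :: "'k ring \<Rightarrow> ('k, 'a) module \<Rightarrow> ('a, 'v) cpx \<Rightarrow> bool" where
  "basic_K K A T \<longleftrightarrow>
     \<not> (\<exists>U :: ('a, 'k list) cpx. indecomposable_K K A U \<and> summand_K K A (cpx_sum U U) T)"


section \<open>Two-term silting complexes\<close>

text \<open>The smallest full triangulated subcategory of \<open>K\<^sup>b(proj)\<close> that contains \<open>add T\<close>.  It is closed
  under isomorphism by the second rule with \<open>i = 0\<close>.\<close>

inductive generated_by :: "'k ring \<Rightarrow> ('k, 'a) module \<Rightarrow> ('a, 'k list) cpx \<Rightarrow> ('a, 'k list) cpx \<Rightarrow> bool"
  for K :: "'k ring" and A :: "('k, 'a) module" and T :: "('a, 'k list) cpx" where
  add: "\<lbrakk>bounded_proj_complex K A U; summand_K K A U (cpx_pow m T)\<rbrakk> \<Longrightarrow> generated_by K A T U"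
| shift: "\<lbrakk>generated_by K A T U; bounded_proj_complex K A Z; isomorphic_K A Z (shift i U)\<rbrakk>
    \<Longrightarrow> generated_by K A T Z"
| cone: "\<lbrakk>generated_by K A T U; generated_by K A T Y; f \<in> chain_maps A U Y;
     bounded_proj_complex K A Z; isomorphic_K A Z (cone U Y f)\<rbrakk> \<Longrightarrow> generated_by K A T Z"

definition silting :: "'k ring \<Rightarrow> ('k, 'a) module \<Rightarrow> ('a, 'k list) cpx \<Rightarrow> bool" where
  "silting K A T \<longleftrightarrow>
     bounded_proj_complex K A T \<and> (\<forall>i>0. hom_K_zero A T (shift i T)) \<and>
     (\<forall>U. bounded_proj_complex K A U \<longrightarrow> generated_by K A T U)"

definition two_term :: "('a, 'v) cpx \<Rightarrow> bool" where
  "two_term T \<longleftrightarrow> (\<forall>n. n \<noteq> -1 \<and> n \<noteq> 0 \<longrightarrow> is_zero (obj T n))"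

definition basic_two_term_silting :: "'k ring \<Rightarrow> ('k, 'a) module \<Rightarrow> ('a, 'k list) cpx \<Rightarrow> bool" where
  "basic_two_term_silting K A T \<longleftrightarrow> two_term T \<and> silting K A T \<and> basic_K K A T"

definition two_silt :: "'k ring \<Rightarrow> ('k, 'a) module \<Rightarrow> ('a, 'k list) cpx set set" where
  "two_silt K A = {K_class K A T |T. basic_two_term_silting K A T}"

definition silt_ge ::
  "('k, 'a) module \<Rightarrow> ('a, 'k list) cpx set \<Rightarrow> ('a, 'k list) cpx set \<Rightarrow> bool" where
  "silt_ge A U Y \<longleftrightarrow> (\<exists>T\<in>U. \<exists>T'\<in>Y. \<forall>i>0. hom_K_zero A T (shift i T'))"

definition two_term_complex ::
  "('a, 'v) module \<Rightarrow> ('v \<Rightarrow> 'v) \<Rightarrow> ('a, 'v) module \<Rightarrow> ('a, 'v) cpx" where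
  "two_term_complex Q g P =
     (let U = (\<lambda>n. if n = -1 then Q else if n = 0 then P else zero_mod)
      in \<lparr>obj = U, dif = (\<lambda>n x. if n = -1 then g x else \<zero>\<^bsub>U (n + 1)\<^esub>)\<rparr>)"

text \<open>The graph of the Adachi--Iyama--Reiten bijection: the class of \<open>M\<close>, written as a pair
  \<open>(M, P)\<close>, corresponds to the class of \<open>(f 0) : P\<^sub>1 \<oplus> P \<rightarrow> P\<^sub>0\<close>.  The module \<open>Q\<close> is a copy of
  \<open>P\<^sub>1 \<oplus> P\<close>, identified along \<open>e\<close>, whose elements have the same type as those of \<open>P\<^sub>0\<close>.\<close>

definition air_corresponds ::
  "'k ring \<Rightarrow> ('k, 'a) module \<Rightarrow> ('a, 'k list) module set \<Rightarrow> ('a, 'k list) cpx set \<Rightarrow> bool" where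
  "air_corresponds K A U S \<longleftrightarrow>
     U \<in> stau_tilt K A \<and> S \<in> two_silt K A \<and>
     (\<exists>M\<in>U. \<exists>P P1 f (P0 :: ('a, 'k list) module) p Q e g.
        support_complement K A M P \<and> basic_mod K A P \<and>
        minimal_presentation K A P1 f P0 p M \<and>
        fd_mod K A Q \<and> e \<in> mod_iso A (mod_sum P1 P) Q \<and>
        g \<in> mod_hom A Q P0 \<and> (\<forall>x\<in>carrier P1. \<forall>y\<in>carrier P. g (e (x, y)) = f x) \<and>
        S = K_class K A (two_term_complex Q g P0))"


section \<open>Extension of scalars\<close>

text \<open>\<open>B \<otimes>\<^sub>A M\<close> for a ring homomorphism \<open>q : A \<rightarrow> B\<close>, as the quotient of the free abelian group on
  \<open>B \<times> M\<close> by the usual relations.\<close>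

definition tensor_free ::
  "('k, 'b) module \<Rightarrow> ('a, 'v) module \<Rightarrow> ('b \<times> 'v \<Rightarrow>\<^sub>0 int) monoid" where
  "tensor_free B M = free_Abelian_group (carrier B \<times> carrier M)"

definition tensor_rel ::
  "('k, 'b) module \<Rightarrow> ('a \<Rightarrow> 'b) \<Rightarrow> ('k, 'a) module \<Rightarrow> ('a, 'v) module \<Rightarrow> ('b \<times> 'v \<Rightarrow>\<^sub>0 int) set" where
  "tensor_rel B q A M = generate (tensor_free B M)
     ({frag_of (b \<oplus>\<^bsub>B\<^esub> b', x) - frag_of (b, x) - frag_of (b', x) |b b' x.
         b \<in> carrier B \<and> b' \<in> carrier B \<and> x \<in> carrier M} \<union>
      {frag_of (b, x \<oplus>\<^bsub>M\<^esub> x') - frag_of (b, x) - frag_of (b, x') |b x x'.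
         b \<in> carrier B \<and> x \<in> carrier M \<and> x' \<in> carrier M} \<union>
      {frag_of (b \<otimes>\<^bsub>B\<^esub> q a, x) - frag_of (b, a \<odot>\<^bsub>M\<^esub> x) |b a x.
         b \<in> carrier B \<and> a \<in> carrier A \<and> x \<in> carrier M})"

definition tensor_mod ::
  "('k, 'b) module \<Rightarrow> ('a \<Rightarrow> 'b) \<Rightarrow> ('k, 'a) module \<Rightarrow> ('a, 'v) module
    \<Rightarrow> ('b, ('b \<times> 'v \<Rightarrow>\<^sub>0 int) set) module" where
  "tensor_mod B q A M =
     mk_mod (carrier (tensor_free B M Mod tensor_rel B q A M)) (tensor_rel B q A M)
       (monoid.mult (tensor_free B M Mod tensor_rel B q A M))
       (\<lambda>b U. \<Union>z\<in>U. tensor_rel B q A M #>\<^bsub>tensor_free B M\<^esub>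
           frag_extend (\<lambda>(b', x). frag_of (b \<otimes>\<^bsub>B\<^esub> b', x)) z)"

definition tensor_map ::
  "('k, 'b) module \<Rightarrow> ('a \<Rightarrow> 'b) \<Rightarrow> ('k, 'a) module \<Rightarrow> ('a, 'w) module \<Rightarrow> ('v \<Rightarrow> 'w)
    \<Rightarrow> ('b \<times> 'v \<Rightarrow>\<^sub>0 int) set \<Rightarrow> ('b \<times> 'w \<Rightarrow>\<^sub>0 int) set" where
  "tensor_map B q A N f U =
     (\<Union>z\<in>U. tensor_rel B q A N #>\<^bsub>tensor_free B N\<^esub> frag_extend (\<lambda>(b, x). frag_of (b, f x)) z)"

definition tensor_cpx ::
  "('k, 'b) module \<Rightarrow> ('a \<Rightarrow> 'b) \<Rightarrow> ('k, 'a) module \<Rightarrow> ('a, 'v) cpx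
    \<Rightarrow> ('b, ('b \<times> 'v \<Rightarrow>\<^sub>0 int) set) cpx" where
  "tensor_cpx B q A U =
     \<lparr>obj = (\<lambda>n. tensor_mod B q A (obj U n)),
      dif = (\<lambda>n. tensor_map B q A (obj U (n + 1)) (dif U n))\<rparr>"

definition ideal_smult :: "'a set \<Rightarrow> ('a, 'v) module \<Rightarrow> 'v set" where
  "ideal_smult I M = generate (add_monoid M) {i \<odot>\<^bsub>M\<^esub> x |i x. i \<in> I \<and> x \<in> carrier M}"

text \<open>\<open>M / I M\<close> as a module over \<open>A / I\<close>: the coset of \<open>a\<close> sends the coset of \<open>x\<close> to the coset of
  \<open>a \<odot> x\<close>.\<close>

definition reduced_mod :: "'a set \<Rightarrow> ('a, 'v) module \<Rightarrow> ('a set, 'v set) module" where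
  "reduced_mod I M = mk_mod (a_rcosets\<^bsub>M\<^esub> (ideal_smult I M)) (ideal_smult I M) (set_add M)
     (\<lambda>C U. \<Union>a\<in>C. \<Union>x\<in>U. ideal_smult I M +>\<^bsub>M\<^esub> (a \<odot>\<^bsub>M\<^esub> x))"


section \<open>The Eisele--Janssens--Raedschelders isomorphism\<close>

definition poset_iso ::
  "'x set \<Rightarrow> ('x \<Rightarrow> 'x \<Rightarrow> bool) \<Rightarrow> 'y set \<Rightarrow> ('y \<Rightarrow> 'y \<Rightarrow> bool) \<Rightarrow> ('x \<Rightarrow> 'y) \<Rightarrow> bool" where
  "poset_iso U ge Y ge' f \<longleftrightarrow>
     bij_betw f U Y \<and> (\<forall>x\<in>U. \<forall>x'\<in>U. ge x x' \<longleftrightarrow> ge' (f x) (f x'))"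

text \<open>\<open>\<Psi>\<close> is the isomorphism \<open>2-silt A \<rightarrow> 2-silt A/I\<close> given by \<open>A/I \<otimes>\<^sub>A -\<close>.\<close>

definition ejr_silting_iso ::
  "'k ring \<Rightarrow> ('k, 'a) module \<Rightarrow> 'a set \<Rightarrow>
    (('a, 'k list) cpx set \<Rightarrow> ('a set, 'k list) cpx set) \<Rightarrow> bool" where
  "ejr_silting_iso K A I \<Psi> \<longleftrightarrow>
     poset_iso (two_silt K A) (silt_ge A)
       (two_silt K (quot_algebra A I)) (silt_ge (quot_algebra A I)) \<Psi> \<and>
     (\<forall>T. basic_two_term_silting K A T \<longrightarrow>
        \<Psi> (K_class K A T) =
        K_class K (quot_algebra A I) (tensor_cpx (quot_algebra A I) (\<lambda>a. I +>\<^bsub>A\<^esub> a) A T))"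

text \<open>\<open>\<Phi>\<close> is the isomorphism of posets that corresponds to \<open>\<Psi>\<close> under the Adachi--Iyama--Reiten
  bijections for \<open>A\<close> and \<open>A/I\<close>.  As \<^term>\<open>air_corresponds\<close> is the graph of a bijection for either
  algebra, this determines the values of \<open>\<Phi>\<close> on \<open>s\<tau>-tilt A\<close>.\<close>

definition ejr_iso ::
  "'k ring \<Rightarrow> ('k, 'a) module \<Rightarrow> 'a set \<Rightarrow>
    (('a, 'k list) module set \<Rightarrow> ('a set, 'k list) module set) \<Rightarrow> bool" where
  "ejr_iso K A I \<Phi> \<longleftrightarrow>
     poset_iso (stau_tilt K A) (stau_ge A)
       (stau_tilt K (quot_algebra A I)) (stau_ge (quot_algebra A I)) \<Phi> \<and>
     (\<exists>\<Psi>. ejr_silting_iso K A I \<Psi> \<and>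
        (\<forall>U\<in>stau_tilt K A. \<exists>S. air_corresponds K A U S \<and>
           air_corresponds K (quot_algebra A I) (\<Phi> U) (\<Psi> S)))"

end

theory Submission
  imports Defs
begin

text \<open>
  Write \<open>B\<close> for \<open>\<Lambda>/I\<close>.  Both sides of the asserted equation are recovered from a two-term complex as
  its cokernel, the cohomology in degree \<open>0\<close>, and taking cokernels commutes with reduction modulo \<open>I\<close>.

  In more detail, the Adachi--Iyama--Reiten correspondence attaches to \<open>M\<close> the class \<open>S\<close> of the complex
  \<open>P\<^sub>1 \<oplus> P \<rightarrow> P\<^sub>0\<close>, whose cokernel is \<open>M\<close>.  The cokernel of the differential into degree \<open>0\<close> is invariant
  under isomorphism in the homotopy category as long as there is no term in degree \<open>1\<close>
  (\<open>is_cokernel_isomorphic_K\<close>).  Hence \<open>M\<close> is the cokernel of any two-term silting complex \<open>T\<close> in \<open>S\<close>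
  (\<open>air_corresponds_cokernel\<close>).  As \<open>B \<otimes> -\<close> is right exact and \<open>B \<otimes> M\<close> is \<open>M / I M\<close>, the
  cokernel of \<open>B \<otimes> T\<close> is \<open>M / I M\<close> (\<open>is_cokernel_ext\<close>).  Now \<open>B \<otimes> T\<close> represents the class that
  corresponds over \<open>B\<close> to \<open>\<Phi>\<close> of the class of \<open>M\<close>, so a member \<open>N\<close> of \<open>\<Phi>\<close> of that class is a cokernel
  of the same complex over \<open>B\<close>, and \<open>N\<close> is isomorphic to \<open>M / I M\<close> by uniqueness of cokernels
  (\<open>is_cokernel_unique\<close>).

  Right exactness is proved directly for \<open>B = \<Lambda>/I\<close>: every element of \<open>B \<otimes> Y\<close> has the form \<open>1 \<otimes> y\<close>, since
  \<open>\<Lambda> \<rightarrow> B\<close> is onto.  If \<open>r : Y \<rightarrow> M\<close> is a cokernel of \<open>d : W \<rightarrow> Y\<close> and \<open>r y\<close> lies in \<open>I M = r (I Y)\<close>, then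
  \<open>y = d w + z\<close> with \<open>z\<close> in \<open>I Y\<close>, and \<open>1 \<otimes> z = 0\<close>.
\<close>

section \<open>Module homomorphisms\<close>

lemma mod_hom_closed:
  "\<lbrakk>h \<in> mod_hom A M N; x \<in> carrier M\<rbrakk> \<Longrightarrow> h x \<in> carrier N"
  by (auto simp: mod_hom_def)

lemma mod_hom_add:
  "\<lbrakk>h \<in> mod_hom A M N; x \<in> carrier M; y \<in> carrier M\<rbrakk> \<Longrightarrow> h (x \<oplus>\<^bsub>M\<^esub> y) = h x \<oplus>\<^bsub>N\<^esub> h y"
  by (auto simp: mod_hom_def)

lemma mod_hom_smult:
  "\<lbrakk>h \<in> mod_hom A M N; a \<in> carrier A; x \<in> carrier M\<rbrakk> \<Longrightarrow> h (a \<odot>\<^bsub>M\<^esub> x) = a \<odot>\<^bsub>N\<^esub> h x"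
  by (auto simp: mod_hom_def)

lemma mod_homI:
  assumes "\<And>x. x \<in> carrier M \<Longrightarrow> h x \<in> carrier N"
    and "\<And>x y. \<lbrakk>x \<in> carrier M; y \<in> carrier M\<rbrakk> \<Longrightarrow> h (x \<oplus>\<^bsub>M\<^esub> y) = h x \<oplus>\<^bsub>N\<^esub> h y"
    and "\<And>a x. \<lbrakk>a \<in> carrier A; x \<in> carrier M\<rbrakk> \<Longrightarrow> h (a \<odot>\<^bsub>M\<^esub> x) = a \<odot>\<^bsub>N\<^esub> h x"
  shows "h \<in> mod_hom A M N"
  using assms by (auto simp: mod_hom_def)

lemma mod_hom_compose:
  assumes "f \<in> mod_hom A M N" "g \<in> mod_hom A N L"
  shows "(\<lambda>x. g (f x)) \<in> mod_hom A M L"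
  using assms by (auto simp: mod_hom_def Pi_iff)

lemma mod_hom_group_hom:
  assumes "h \<in> mod_hom A M N" "abelian_group M" "abelian_group N"
  shows "group_hom (add_monoid M) (add_monoid N) h"
proof -
  have "group (add_monoid M)" "group (add_monoid N)"
    using assms by (simp_all add: abelian_group.a_group)
  then show ?thesis
    using assms(1) by (auto simp: group_hom_def group_hom_axioms_def hom_def mod_hom_def)
qed

lemma mod_hom_zero:
  assumes "h \<in> mod_hom A M N" "abelian_group M" "abelian_group N"
  shows "h \<zero>\<^bsub>M\<^esub> = \<zero>\<^bsub>N\<^esub>"
  using group_hom.hom_one[OF mod_hom_group_hom[OF assms]] by simp

lemma mod_hom_minus:
  assumes "h \<in> mod_hom A M N" "abelian_group M" "abelian_group N"
    and "x \<in> carrier M" "y \<in> carrier M"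
  shows "h (x \<ominus>\<^bsub>M\<^esub> y) = h x \<ominus>\<^bsub>N\<^esub> h y"
proof -
  have "h (\<ominus>\<^bsub>M\<^esub> y) = \<ominus>\<^bsub>N\<^esub> h y"
    using group_hom.hom_inv[OF mod_hom_group_hom[OF assms(1-3)], of y] assms(5)
    by (simp add: a_inv_def)
  then show ?thesis
    using assms by (simp add: a_minus_def mod_hom_add abelian_group.a_inv_closed)
qed

lemma abelian_group_minus_eq_zero_iff:
  assumes "abelian_group M" "x \<in> carrier M" "y \<in> carrier M"
  shows "x \<ominus>\<^bsub>M\<^esub> y = \<zero>\<^bsub>M\<^esub> \<longleftrightarrow> x = y"
proof -
  interpret abelian_group M by fact
  show ?thesis
    using assms(2,3) by (metis a_inv_closed minus_eq minus_equality minus_minus r_neg)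
qed

lemma isomorphic_mod_sym:
  assumes "isomorphic_mod A M N" "left_module A M"
  shows "isomorphic_mod A N M"
proof -
  interpret left_module A M by fact
  obtain h where h: "h \<in> mod_hom A M N" and bij: "bij_betw h (carrier M) (carrier N)"
    using assms(1) by (auto simp: isomorphic_mod_def mod_iso_def)
  define g where "g = the_inv_into (carrier M) h"
  have gh: "g (h x) = x" if "x \<in> carrier M" for x
    using bij that by (simp add: g_def bij_betw_def the_inv_into_f_f)
  have N: "carrier N = h ` carrier M"
    using bij by (simp add: bij_betw_def)
  have "g \<in> mod_hom A N M"
    by (rule mod_homI)
      (auto simp: N gh smult_closed simp flip: mod_hom_add[OF h] mod_hom_smult[OF h])
  moreover have "bij_betw g (carrier N) (carrier M)"
    unfolding g_def by (rule bij_betw_the_inv_into[OF bij])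
  ultimately show ?thesis
    by (auto simp: isomorphic_mod_def mod_iso_def)
qed

lemma isomorphic_mod_trans:
  assumes "isomorphic_mod A L M" "isomorphic_mod A M N"
  shows "isomorphic_mod A L N"
proof -
  obtain f g where "f \<in> mod_iso A L M" "g \<in> mod_iso A M N"
    using assms by (auto simp: isomorphic_mod_def)
  then have "(\<lambda>x. g (f x)) \<in> mod_iso A L N"
    by (auto simp: mod_iso_def mod_hom_compose comp_def dest: bij_betw_trans)
  then show ?thesis
    by (auto simp: isomorphic_mod_def)
qed


section \<open>Cokernels\<close>

text \<open>The sequence \<open>W \<rightarrow> Y \<rightarrow> N \<rightarrow> 0\<close> with maps \<open>d\<close> and \<open>q\<close> is exact.  Neither \<open>W\<close> nor \<open>d\<close> is required
  to be linear; only the image of \<open>d\<close> matters.\<close>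

definition is_cokernel ::
  "('k, 'a) module \<Rightarrow> ('a, 'u) module \<Rightarrow> ('u \<Rightarrow> 'v) \<Rightarrow> ('a, 'v) module \<Rightarrow> ('a, 'w) module
    \<Rightarrow> ('v \<Rightarrow> 'w) \<Rightarrow> bool" where
  "is_cokernel A W d Y N q \<longleftrightarrow>
     q \<in> mod_hom A Y N \<and> q ` carrier Y = carrier N \<and>
     {y \<in> carrier Y. q y = \<zero>\<^bsub>N\<^esub>} = d ` carrier W"

lemma is_cokernel_iso:
  assumes "is_cokernel A W d Y N q" "s \<in> mod_iso A N N'" "abelian_group N" "abelian_group N'"
  shows "is_cokernel A W d Y N' (\<lambda>y. s (q y))"
proof -
  have s: "s \<in> mod_hom A N N'" "inj_on s (carrier N)" "s ` carrier N = carrier N'"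
    using assms(2) by (auto simp: mod_iso_def bij_betw_def)
  have q: "q \<in> mod_hom A Y N" "q ` carrier Y = carrier N"
    and ker: "{y \<in> carrier Y. q y = \<zero>\<^bsub>N\<^esub>} = d ` carrier W"
    using assms(1) by (auto simp: is_cokernel_def)
  have "s (q y) = \<zero>\<^bsub>N'\<^esub> \<longleftrightarrow> q y = \<zero>\<^bsub>N\<^esub>" if "y \<in> carrier Y" for y
    using that mod_hom_closed[OF q(1)] inj_onD[OF s(2)] mod_hom_zero[OF s(1) assms(3,4)]
      abelian_monoid.zero_closed[OF abelian_group.axioms(1)[OF assms(3)]]
    by metis
  with ker have "{y \<in> carrier Y. s (q y) = \<zero>\<^bsub>N'\<^esub>} = d ` carrier W"
    by blast
  moreover have "(\<lambda>y. s (q y)) ` carrier Y = carrier N'"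
    using q(2) s(3) by (metis image_image)
  ultimately show ?thesis
    using mod_hom_compose[OF q(1) s(1)] by (simp add: is_cokernel_def)
qed

lemma is_cokernel_unique:
  assumes "left_module A Y" "abelian_group N" "abelian_group N'"
    and N: "is_cokernel A W d Y N q" and N': "is_cokernel A W d Y N' q'"
  shows "isomorphic_mod A N N'"
proof -
  interpret Y: left_module A Y by fact
  have q: "q \<in> mod_hom A Y N" "q' \<in> mod_hom A Y N'"
    and im: "q ` carrier Y = carrier N" "q' ` carrier Y = carrier N'"
    and ker: "\<And>y. y \<in> carrier Y \<Longrightarrow> q y = \<zero>\<^bsub>N\<^esub> \<longleftrightarrow> q' y = \<zero>\<^bsub>N'\<^esub>"
    using N N' unfolding is_cokernel_def by blast+
  have eq: "q x = q y \<longleftrightarrow> q' x = q' y" if "x \<in> carrier Y" "y \<in> carrier Y" for x y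
  proof -
    have "q x = q y \<longleftrightarrow> q (x \<ominus>\<^bsub>Y\<^esub> y) = \<zero>\<^bsub>N\<^esub>"
      using that q(1) assms(2) Y.M.abelian_group_axioms
      by (simp add: mod_hom_minus[OF q(1)] abelian_group_minus_eq_zero_iff mod_hom_closed[OF q(1)])
    moreover have "q' x = q' y \<longleftrightarrow> q' (x \<ominus>\<^bsub>Y\<^esub> y) = \<zero>\<^bsub>N'\<^esub>"
      using that q(2) assms(3) Y.M.abelian_group_axioms
      by (simp add: mod_hom_minus[OF q(2)] abelian_group_minus_eq_zero_iff mod_hom_closed[OF q(2)])
    ultimately show ?thesis
      using ker[of "x \<ominus>\<^bsub>Y\<^esub> y"] that by simp
  qed
  define t where "t n = (SOME y. y \<in> carrier Y \<and> q y = n)" for n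
  have t: "t (q y) \<in> carrier Y" "q (t (q y)) = q y" if "y \<in> carrier Y" for y
    using someI[of "\<lambda>x. x \<in> carrier Y \<and> q x = q y" y] that by (auto simp: t_def)
  define h where "h n = q' (t n)" for n
  have h: "h (q y) = q' y" if "y \<in> carrier Y" for y
    using eq[of "t (q y)" y] t[OF that] that by (simp add: h_def)
  have "h \<in> mod_hom A N N'"
  proof (rule mod_homI)
    fix n assume "n \<in> carrier N"
    then obtain y where "y \<in> carrier Y" "n = q y"
      using im(1) by blast
    then show "h n \<in> carrier N'"
      by (simp add: h mod_hom_closed[OF q(2)])
  next
    fix m n assume "m \<in> carrier N" "n \<in> carrier N"
    then obtain x y where "x \<in> carrier Y" "y \<in> carrier Y" "m = q x" "n = q y"
      using im(1) by blast
    then show "h (m \<oplus>\<^bsub>N\<^esub> n) = h m \<oplus>\<^bsub>N'\<^esub> h n"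
      using h[of "x \<oplus>\<^bsub>Y\<^esub> y"] by (simp add: h mod_hom_add[OF q(1)] mod_hom_add[OF q(2)])
  next
    fix a n assume "a \<in> carrier A" "n \<in> carrier N"
    moreover from this obtain y where "y \<in> carrier Y" "n = q y"
      using im(1) by blast
    ultimately show "h (a \<odot>\<^bsub>N\<^esub> n) = a \<odot>\<^bsub>N'\<^esub> h n"
      using h[of "a \<odot>\<^bsub>Y\<^esub> y"]
      by (simp add: h Y.smult_closed mod_hom_smult[OF q(1)] mod_hom_smult[OF q(2)])
  qed
  moreover have "bij_betw h (carrier N) (carrier N')"
  proof -
    have "inj_on h (q ` carrier Y)"
      by (rule inj_onI) (auto simp: h eq)
    moreover have "h ` q ` carrier Y = q' ` carrier Y"
      using h by (auto simp: image_image)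
    ultimately show ?thesis
      by (simp add: bij_betw_def im)
  qed
  ultimately show ?thesis
    by (auto simp: isomorphic_mod_def mod_iso_def)
qed


section \<open>Homotopy invariance of the cokernel\<close>

text \<open>A sequence of abelian groups and maps whose term in degree \<open>1\<close> is zero.  For a complex of this
  kind the cokernel of the differential from degree \<open>-1\<close> to degree \<open>0\<close> is the cohomology in degree
  \<open>0\<close>.  The maps need not be linear, which spares a proof of linearity for extensions of scalars.\<close>

definition ends_in_degree_0 :: "('a, 'v) cpx \<Rightarrow> bool" where
  "ends_in_degree_0 U \<longleftrightarrow>
     (\<forall>n. abelian_group (obj U n) \<and> dif U n \<in> carrier (obj U n) \<rightarrow> carrier (obj U (n + 1))) \<and>
     is_zero (obj U 1)"

text \<open>A family of maps that is homotopic to the identity moves an element of degree \<open>0\<close> only by a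
  boundary, as the part of the homotopy that passes through degree \<open>1\<close> vanishes.\<close>

lemma homotopic_id_degree_0:
  assumes U: "ends_in_degree_0 U" and hom: "homotopic_maps A U U f (\<lambda>n x. x)"
    and x: "x \<in> carrier (obj U 0)"
  shows "\<exists>v\<in>carrier (obj U (-1)). f 0 x = x \<oplus>\<^bsub>obj U 0\<^esub> dif U (-1) v"
proof -
  obtain h where h: "\<And>n. h n \<in> mod_hom A (obj U n) (obj U (n - 1))"
    and eq: "\<And>n x. x \<in> carrier (obj U n) \<Longrightarrow>
      f n x = x \<oplus>\<^bsub>obj U n\<^esub> (dif U (n - 1) (h n x) \<oplus>\<^bsub>obj U n\<^esub> h (n + 1) (dif U n x))"
    using hom unfolding homotopic_maps_def by blast
  have grp: "abelian_group (obj U n)" for n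
    using U by (simp add: ends_in_degree_0_def)
  have cl: "dif U n \<in> carrier (obj U n) \<rightarrow> carrier (obj U (n + 1))" for n
    using U by (simp add: ends_in_degree_0_def)
  have hx: "h 0 x \<in> carrier (obj U (-1))"
    using mod_hom_closed[OF h[of 0] x] by simp
  have dhx: "dif U (-1) (h 0 x) \<in> carrier (obj U 0)"
    using cl[of "-1"] hx by auto
  have "dif U 0 x = \<zero>\<^bsub>obj U 1\<^esub>"
    using cl[of 0] x U by (auto simp: ends_in_degree_0_def is_zero_def)
  then have "h 1 (dif U 0 x) = \<zero>\<^bsub>obj U 0\<^esub>"
    using mod_hom_zero[OF h[of 1] grp grp] by simp
  then have "f 0 x = x \<oplus>\<^bsub>obj U 0\<^esub> dif U (-1) (h 0 x)"
    using eq[OF x] dhx by (simp add: abelian_monoid.r_zero[OF abelian_group.axioms(1)[OF grp]])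
  with hx show ?thesis by blast
qed

text \<open>If \<open>q\<close> is a cokernel for \<open>U\<close>, then \<open>q \<circ> g\<^sub>0\<close> is one for \<open>Y\<close>, where \<open>g : Y \<rightarrow> U\<close> is a homotopy
  equivalence.\<close>

lemma is_cokernel_isomorphic_K:
  assumes "isomorphic_K A U Y" and U: "ends_in_degree_0 U" and Y: "ends_in_degree_0 Y"
    and d: "dif Y (-1) \<in> mod_hom A (obj Y (-1)) (obj Y 0)" and N: "abelian_group N"
    and cok: "is_cokernel A (obj U (-1)) (dif U (-1)) (obj U 0) N q"
  shows "\<exists>r. is_cokernel A (obj Y (-1)) (dif Y (-1)) (obj Y 0) N r"
proof -
  obtain f g where f: "f \<in> chain_maps A U Y" and g: "g \<in> chain_maps A Y U"
    and gf: "homotopic_maps A U U (\<lambda>n x. g n (f n x)) (\<lambda>n x. x)"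
    and fg: "homotopic_maps A Y Y (\<lambda>n y. f n (g n y)) (\<lambda>n y. y)"
    using assms(1) by (auto simp: isomorphic_K_def)
  have f0: "f n \<in> mod_hom A (obj U n) (obj Y n)" and g0: "g n \<in> mod_hom A (obj Y n) (obj U n)" for n
    using f g by (auto simp: chain_maps_def)
  have fd: "f 0 (dif U (-1) x) = dif Y (-1) (f (-1) x)" if "x \<in> carrier (obj U (-1))" for x
  proof -
    have "f (-1 + 1) (dif U (-1) x) = dif Y (-1) (f (-1) x)"
      using f that unfolding chain_maps_def by blast
    then show ?thesis by simp
  qed
  have gd: "g 0 (dif Y (-1) y) = dif U (-1) (g (-1) y)" if "y \<in> carrier (obj Y (-1))" for y
  proof -
    have "g (-1 + 1) (dif Y (-1) y) = dif U (-1) (g (-1) y)"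
      using g that unfolding chain_maps_def by blast
    then show ?thesis by simp
  qed
  have dU: "dif U (-1) x \<in> carrier (obj U 0)" if "x \<in> carrier (obj U (-1))" for x
    using U that unfolding ends_in_degree_0_def by (metis PiE add.commute add.right_inverse)
  note dY = mod_hom_closed[OF d]
  interpret N: abelian_group N by fact
  interpret Y0: abelian_group "obj Y 0" using Y by (simp add: ends_in_degree_0_def)
  interpret Y1: abelian_group "obj Y (-1)" using Y by (simp add: ends_in_degree_0_def)
  have q: "q \<in> mod_hom A (obj U 0) N" and im: "q ` carrier (obj U 0) = carrier N"
    and ker: "{y \<in> carrier (obj U 0). q y = \<zero>\<^bsub>N\<^esub>} = dif U (-1) ` carrier (obj U (-1))"
    using cok by (auto simp: is_cokernel_def)
  have qd: "q (dif U (-1) x) = \<zero>\<^bsub>N\<^esub>" if "x \<in> carrier (obj U (-1))" for x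
    using ker that by blast
  define r where "r y = q (g 0 y)" for y
  have r: "r \<in> mod_hom A (obj Y 0) N"
    unfolding r_def by (rule mod_hom_compose[OF g0 q])
  have surj: "carrier N \<subseteq> r ` carrier (obj Y 0)"
  proof
    fix n assume "n \<in> carrier N"
    then obtain x where x: "x \<in> carrier (obj U 0)" "n = q x"
      using im by blast
    obtain v where v: "v \<in> carrier (obj U (-1))" "g 0 (f 0 x) = x \<oplus>\<^bsub>obj U 0\<^esub> dif U (-1) v"
      using homotopic_id_degree_0[OF U gf x(1)] by blast
    have "r (f 0 x) = n"
      using v x by (simp add: r_def mod_hom_add[OF q] dU qd mod_hom_closed[OF q])
    then show "n \<in> r ` carrier (obj Y 0)"
      using mod_hom_closed[OF f0 x(1)] by blast
  qed
  have "y \<in> dif Y (-1) ` carrier (obj Y (-1))" if y: "y \<in> carrier (obj Y 0)" "r y = \<zero>\<^bsub>N\<^esub>" for y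
  proof -
    have "g 0 y \<in> dif U (-1) ` carrier (obj U (-1))"
      using y mod_hom_closed[OF g0 y(1)] ker by (auto simp: r_def)
    then obtain u where u: "u \<in> carrier (obj U (-1))" "g 0 y = dif U (-1) u"
      by blast
    obtain v where v: "v \<in> carrier (obj Y (-1))" "f 0 (g 0 y) = y \<oplus>\<^bsub>obj Y 0\<^esub> dif Y (-1) v"
      using homotopic_id_degree_0[OF Y fg y(1)] by blast
    have fu: "f (-1) u \<in> carrier (obj Y (-1))"
      using mod_hom_closed[OF f0 u(1)] .
    have "dif Y (-1) (f (-1) u) = y \<oplus>\<^bsub>obj Y 0\<^esub> dif Y (-1) v"
      using v u fd by simp
    then have "y = dif Y (-1) (f (-1) u) \<ominus>\<^bsub>obj Y 0\<^esub> dif Y (-1) v"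
      using y(1) dY[OF v(1)] dY[OF fu]
      by (simp add: a_minus_def Y0.add.inv_solve_right)
    also have "\<dots> = dif Y (-1) (f (-1) u \<ominus>\<^bsub>obj Y (-1)\<^esub> v)"
      using mod_hom_minus[OF d Y1.abelian_group_axioms Y0.abelian_group_axioms fu v(1)] by simp
    finally show ?thesis
      using fu v(1) by blast
  qed
  moreover have "r (dif Y (-1) y) = \<zero>\<^bsub>N\<^esub>" if "y \<in> carrier (obj Y (-1))" for y
    using that by (simp add: r_def gd qd mod_hom_closed[OF g0])
  ultimately have "{y \<in> carrier (obj Y 0). r y = \<zero>\<^bsub>N\<^esub>} = dif Y (-1) ` carrier (obj Y (-1))"
    using dY by blast
  then show ?thesis
    using r surj mod_hom_closed[OF r] unfolding is_cokernel_def by blast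
qed


section \<open>The quotient algebra and the reduction of a module\<close>

context left_module
begin

lemma smult_r_null: "a \<in> carrier R \<Longrightarrow> a \<odot>\<^bsub>M\<^esub> \<zero>\<^bsub>M\<^esub> = \<zero>\<^bsub>M\<^esub>"
  by (metis M.add.one_closed M.l_zero M.add.r_cancel_one' smult_closed smult_r_distr)

lemma smult_r_minus:
  assumes "a \<in> carrier R" "x \<in> carrier M"
  shows "a \<odot>\<^bsub>M\<^esub> (\<ominus>\<^bsub>M\<^esub> x) = \<ominus>\<^bsub>M\<^esub> (a \<odot>\<^bsub>M\<^esub> x)"
proof -
  have "a \<odot>\<^bsub>M\<^esub> (\<ominus>\<^bsub>M\<^esub> x) \<oplus>\<^bsub>M\<^esub> a \<odot>\<^bsub>M\<^esub> x = \<zero>\<^bsub>M\<^esub>"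
    using assms by (simp add: M.l_neg smult_r_null flip: smult_r_distr)
  then show ?thesis
    using assms by (simp add: smult_closed M.minus_equality)
qed

end

context
  fixes A :: "('a, 'r) ring_scheme" and M :: "('a, 'v) module" and I :: "'a set"
  assumes M: "left_module A M" and I: "ideal I A"
begin

interpretation left_module A M by (rule M)
interpretation I: ideal I A by (rule I)

lemma ideal_smult_gens: "{i \<odot>\<^bsub>M\<^esub> x |i x. i \<in> I \<and> x \<in> carrier M} \<subseteq> carrier M"
  using I.Icarr smult_closed by auto

lemma subgroup_ideal_smult: "subgroup (ideal_smult I M) (add_monoid M)"
  using M.add.generate_is_subgroup[of "{i \<odot>\<^bsub>M\<^esub> x |i x. i \<in> I \<and> x \<in> carrier M}"]
    ideal_smult_gens by (simp add: ideal_smult_def)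

lemma abelian_subgroup_ideal_smult: "abelian_subgroup (ideal_smult I M) M"
  by (intro abelian_subgroupI3 additive_subgroup.intro subgroup_ideal_smult)
    (rule M.abelian_group_axioms)

lemma ideal_smult_subset:
  assumes "x \<in> ideal_smult I M"
  shows "x \<in> carrier M"
  using subgroup.subset[OF subgroup_ideal_smult] assms by auto

lemma smult_mem_ideal_smult:
  "\<lbrakk>i \<in> I; x \<in> carrier M\<rbrakk> \<Longrightarrow> i \<odot>\<^bsub>M\<^esub> x \<in> ideal_smult I M"
  by (auto simp: ideal_smult_def intro: generate.incl)

lemma ideal_smult_induct [consumes 1, case_names zero smult minus add]:
  assumes x: "x \<in> ideal_smult I M"
    and zero: "Pr \<zero>\<^bsub>M\<^esub>"
    and smult: "\<And>i x. \<lbrakk>i \<in> I; x \<in> carrier M\<rbrakk> \<Longrightarrow> Pr (i \<odot>\<^bsub>M\<^esub> x)"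
    and minus: "\<And>x. \<lbrakk>x \<in> carrier M; Pr x\<rbrakk> \<Longrightarrow> Pr (\<ominus>\<^bsub>M\<^esub> x)"
    and add: "\<And>x y. \<lbrakk>x \<in> carrier M; y \<in> carrier M; Pr x; Pr y\<rbrakk> \<Longrightarrow> Pr (x \<oplus>\<^bsub>M\<^esub> y)"
  shows "Pr x"
  using x unfolding ideal_smult_def
proof (induction rule: generate.induct)
  case one
  show ?case using zero by simp
next
  case (incl h)
  then show ?case using smult by auto
next
  case (inv h)
  then obtain i y where "i \<in> I" "y \<in> carrier M" "h = i \<odot>\<^bsub>M\<^esub> y"
    by auto
  then have "Pr (\<ominus>\<^bsub>M\<^esub> h)"
    using smult minus smult_closed I.Icarr by blast
  then show ?case by (simp add: a_inv_def)
next
  case (eng x y)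
  moreover from this have "x \<in> carrier M" "y \<in> carrier M"
    using ideal_smult_subset by (auto simp: ideal_smult_def)
  ultimately show ?case using add by simp
qed

lemma ideal_smult_smult_closed:
  assumes "a \<in> carrier A" "x \<in> ideal_smult I M"
  shows "a \<odot>\<^bsub>M\<^esub> x \<in> ideal_smult I M"
  using assms(2)
proof (induction rule: ideal_smult_induct)
  case zero
  then show ?case
    using assms subgroup.one_closed[OF subgroup_ideal_smult] by (simp add: smult_r_null)
next
  case (smult i x)
  then have "a \<odot>\<^bsub>M\<^esub> (i \<odot>\<^bsub>M\<^esub> x) = (a \<otimes>\<^bsub>A\<^esub> i) \<odot>\<^bsub>M\<^esub> x"
    using assms(1) I.Icarr by (simp add: smult_assoc1)
  then show ?case
    using smult smult_mem_ideal_smult I.I_l_closed assms(1) by simp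
next
  case (minus x)
  then show ?case
    using assms(1) subgroup.m_inv_closed[OF subgroup_ideal_smult]
    by (simp add: smult_r_minus flip: a_inv_def)
next
  case (add x y)
  then show ?case
    using assms(1) subgroup.m_closed[OF subgroup_ideal_smult]
    by (simp add: smult_r_distr)
qed

end

lemma abelian_group_of_comm_group:
  assumes "comm_group G" "carrier R = carrier G" "ring.add R = monoid.mult G" "\<zero>\<^bsub>R\<^esub> = \<one>\<^bsub>G\<^esub>"
  shows "abelian_group R"
proof -
  interpret comm_group G by fact
  show ?thesis
    by (rule abelian_groupI) (simp_all add: assms m_assoc l_inv_ex, rule m_comm)
qed

lemma quot_algebra_simps:
  "carrier (quot_algebra A I) = a_rcosets\<^bsub>A\<^esub> I"
  "monoid.mult (quot_algebra A I) = rcoset_mult A I"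
  "\<one>\<^bsub>quot_algebra A I\<^esub> = I +>\<^bsub>A\<^esub> \<one>\<^bsub>A\<^esub>"
  "\<zero>\<^bsub>quot_algebra A I\<^esub> = I"
  "ring.add (quot_algebra A I) = set_add A"
  by (simp_all add: quot_algebra_def FactRing_def)

lemma ring_quot_algebra:
  assumes "ideal I A"
  shows "ring (quot_algebra A I)"
proof -
  interpret Q: ring "A Quot I"
    using assms by (rule ideal.quotient_is_ring)
  show ?thesis
    by (intro ringI abelian_groupI monoidI)
      (simp_all add: quot_algebra_def Q.a_assoc Q.m_assoc Q.l_distr Q.r_distr
        Q.add.l_inv_ex, rule Q.a_comm)
qed

lemma quot_algebra_hom:
  assumes "ideal I A"
  shows "(+>\<^bsub>A\<^esub>) I \<in> ring_hom A (quot_algebra A I)"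
  using ideal.rcos_ring_hom[OF assms] by (simp add: ring_hom_def quot_algebra_def)

lemma quot_algebra_surj: "carrier (quot_algebra A I) = (+>\<^bsub>A\<^esub>) I ` carrier A"
  by (auto simp: quot_algebra_simps A_RCOSETS_def')

lemma reduced_mod_simps:
  "carrier (reduced_mod I M) = (+>\<^bsub>M\<^esub>) (ideal_smult I M) ` carrier M"
  "\<zero>\<^bsub>reduced_mod I M\<^esub> = ideal_smult I M"
  "ring.add (reduced_mod I M) = set_add M"
  by (auto simp: reduced_mod_def mk_mod_def A_RCOSETS_def')

lemma reduced_mod_smult:
  assumes "left_module A M" "ideal I A" "a \<in> carrier A" "x \<in> carrier M"
  shows "(I +>\<^bsub>A\<^esub> a) \<odot>\<^bsub>reduced_mod I M\<^esub> (ideal_smult I M +>\<^bsub>M\<^esub> x) =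
    ideal_smult I M +>\<^bsub>M\<^esub> (a \<odot>\<^bsub>M\<^esub> x)"
proof -
  interpret left_module A M by fact
  define J where "J = ideal_smult I M"
  interpret I: ideal I A by fact
  interpret J: abelian_subgroup J M
    unfolding J_def by (rule abelian_subgroup_ideal_smult[OF assms(1,2)])
  have same: "J +>\<^bsub>M\<^esub> (a' \<odot>\<^bsub>M\<^esub> x') = J +>\<^bsub>M\<^esub> (a \<odot>\<^bsub>M\<^esub> x)"
    if a': "a' \<in> I +>\<^bsub>A\<^esub> a" and x': "x' \<in> J +>\<^bsub>M\<^esub> x" for a' x'
  proof -
    obtain i j where i: "i \<in> I" "a' = i \<oplus>\<^bsub>A\<^esub> a" and j: "j \<in> J" "x' = j \<oplus>\<^bsub>M\<^esub> x"
      using a' x' by (auto simp: a_r_coset_def')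
    have ic: "i \<in> carrier A" and jc: "j \<in> carrier M"
      using i j I.Icarr J.a_Hcarr by auto
    define k where "k = i \<odot>\<^bsub>M\<^esub> x' \<oplus>\<^bsub>M\<^esub> a \<odot>\<^bsub>M\<^esub> j"
    have x'c: "x' \<in> carrier M"
      using j jc assms(4) by simp
    have k: "k \<in> J"
      unfolding k_def J_def using i j x'c assms(3)
      by (intro J.a_closed[unfolded J_def] smult_mem_ideal_smult[OF assms(1,2)]
          ideal_smult_smult_closed[OF assms(1,2)]) (auto simp: J_def)
    have "a' \<odot>\<^bsub>M\<^esub> x' = i \<odot>\<^bsub>M\<^esub> x' \<oplus>\<^bsub>M\<^esub> a \<odot>\<^bsub>M\<^esub> (j \<oplus>\<^bsub>M\<^esub> x)"
      using i(2) j(2) ic jc assms(3,4) x'c by (simp add: smult_l_distr)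
    also have "\<dots> = k \<oplus>\<^bsub>M\<^esub> a \<odot>\<^bsub>M\<^esub> x"
      unfolding k_def using ic jc assms(3,4) x'c
      by (simp add: smult_r_distr smult_closed M.a_assoc)
    finally have "a' \<odot>\<^bsub>M\<^esub> x' \<in> J +>\<^bsub>M\<^esub> (a \<odot>\<^bsub>M\<^esub> x)"
      using k by (auto simp: a_r_coset_def')
    then show ?thesis
      using M.a_repr_independence[of _ J] J.a_subgroup assms(3,4) smult_closed by metis
  qed
  have "a \<in> I +>\<^bsub>A\<^esub> a" "x \<in> J +>\<^bsub>M\<^esub> x"
    using I.a_rcos_self J.a_rcos_self assms(3,4) by auto
  then have "(\<Union>a'\<in>I +>\<^bsub>A\<^esub> a. \<Union>x'\<in>J +>\<^bsub>M\<^esub> x. J +>\<^bsub>M\<^esub> (a' \<odot>\<^bsub>M\<^esub> x')) =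
      J +>\<^bsub>M\<^esub> (a \<odot>\<^bsub>M\<^esub> x)"
    using same by blast
  then show ?thesis
    by (simp add: reduced_mod_def mk_mod_def J_def)
qed

lemma reduced_mod_add:
  assumes "left_module A M" "ideal I A" "x \<in> carrier M" "y \<in> carrier M"
  shows "(ideal_smult I M +>\<^bsub>M\<^esub> x) \<oplus>\<^bsub>reduced_mod I M\<^esub> (ideal_smult I M +>\<^bsub>M\<^esub> y) =
    ideal_smult I M +>\<^bsub>M\<^esub> (x \<oplus>\<^bsub>M\<^esub> y)"
  using abelian_subgroup.a_rcos_sum[OF abelian_subgroup_ideal_smult[OF assms(1,2)] assms(3,4)]
  by (simp add: reduced_mod_simps)

lemma reduced_mod_eq_zero_iff:
  assumes "left_module A M" "ideal I A" "x \<in> carrier M"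
  shows "ideal_smult I M +>\<^bsub>M\<^esub> x = \<zero>\<^bsub>reduced_mod I M\<^esub> \<longleftrightarrow> x \<in> ideal_smult I M"
proof -
  interpret left_module A M by fact
  show ?thesis
    using subgroup_ideal_smult[OF assms(1,2)] M.a_coset_join1 M.a_coset_join2 assms(3)
    by (auto simp: reduced_mod_simps)
qed

lemma left_module_reduced_mod:
  assumes "left_module A M" "ideal I A"
  shows "left_module (quot_algebra A I) (reduced_mod I M)"
proof -
  interpret left_module A M by fact
  interpret I: ideal I A by fact
  interpret B: ring "quot_algebra A I"
    by (rule ring_quot_algebra[OF assms(2)])
  interpret J: abelian_subgroup "ideal_smult I M" M
    by (rule abelian_subgroup_ideal_smult[OF assms(1,2)])
  have grp: "abelian_group (reduced_mod I M)"
    by (rule abelian_group_of_comm_group[OF J.a_factorgroup_is_comm_group])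
      (simp_all add: reduced_mod_def mk_mod_def A_FactGroup_def FactGroup_def A_RCOSETS_def
        set_add_def)
  note [simp] = reduced_mod_smult[OF assms] reduced_mod_add[OF assms]
  have addB: "(I +>\<^bsub>A\<^esub> a) \<oplus>\<^bsub>quot_algebra A I\<^esub> (I +>\<^bsub>A\<^esub> b) = I +>\<^bsub>A\<^esub> (a \<oplus>\<^bsub>A\<^esub> b)"
    and multB: "(I +>\<^bsub>A\<^esub> a) \<otimes>\<^bsub>quot_algebra A I\<^esub> (I +>\<^bsub>A\<^esub> b) = I +>\<^bsub>A\<^esub> (a \<otimes>\<^bsub>A\<^esub> b)"
    if "a \<in> carrier A" "b \<in> carrier A" for a b
    using ring_hom_add[OF quot_algebra_hom[OF assms(2)] that]
      ring_hom_mult[OF quot_algebra_hom[OF assms(2)] that] by simp_all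
  show ?thesis
    by (intro left_module.intro B.ring_axioms grp left_module_axioms.intro)
      (auto simp: quot_algebra_surj reduced_mod_simps(1) quot_algebra_simps(3) addB multB
        smult_closed smult_l_distr smult_r_distr smult_assoc1 smult_one)
qed

lemma ideal_smult_lift:
  assumes "left_module A Y" "left_module A M" "ideal I A"
    and q: "q \<in> mod_hom A Y M" "q ` carrier Y = carrier M"
    and "m \<in> ideal_smult I M"
  shows "\<exists>y\<in>ideal_smult I Y. q y = m"
proof -
  interpret M: left_module A M by fact
  interpret Y: left_module A Y by fact
  interpret J: abelian_subgroup "ideal_smult I Y" Y
    by (rule abelian_subgroup_ideal_smult[OF assms(1,3)])
  interpret q: group_hom "add_monoid Y" "add_monoid M" q
    by (rule mod_hom_group_hom[OF q(1) Y.M.abelian_group_axioms M.M.abelian_group_axioms])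
  show ?thesis
    using assms(6)
  proof (induction rule: ideal_smult_induct[OF assms(2,3), consumes 1, case_names zero smult minus add])
    case zero
    then show ?case using q.hom_one J.zero_closed by auto
  next
    case (smult i x)
    then obtain y where "y \<in> carrier Y" "x = q y" using q(2) by blast
    then show ?case
      using smult smult_mem_ideal_smult[OF assms(1,3), of i y] mod_hom_smult[OF q(1)]
        ideal.Icarr[OF assms(3)] by metis
  next
    case (minus x)
    then obtain y where y: "y \<in> ideal_smult I Y" "q y = x" by blast
    then have "q (\<ominus>\<^bsub>Y\<^esub> y) = \<ominus>\<^bsub>M\<^esub> x"
      using q.hom_inv[of y] J.a_Hcarr by (simp add: a_inv_def)
    then show ?case using J.a_inv_closed y(1) by blast
  next
    case (add x y)
    then obtain u v where "u \<in> ideal_smult I Y" "q u = x" "v \<in> ideal_smult I Y" "q v = y"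
      by blast
    moreover from this have "q (u \<oplus>\<^bsub>Y\<^esub> v) = x \<oplus>\<^bsub>M\<^esub> y"
      using mod_hom_add[OF q(1)] J.a_Hcarr by simp
    ultimately show ?case using J.a_closed by blast
  qed
qed


section \<open>Extension of scalars\<close>

text \<open>The tensor product \<open>B \<otimes>\<^sub>A M\<close> along a homomorphism \<open>q : A \<rightarrow> B\<close> of rings, written \<open>ext M\<close> below.\<close>

locale scalar_extension = A: ring A + B: ring B
  for A :: "('k, 'a) module" and B :: "('k, 'b) module" +
  fixes q :: "'a \<Rightarrow> 'b"
  assumes q: "q \<in> ring_hom A B"
begin

lemma q_closed: "a \<in> carrier A \<Longrightarrow> q a \<in> carrier B"
  using q by (rule ring_hom_closed)

abbreviation free :: "('a, 'v) module \<Rightarrow> ('b \<times> 'v \<Rightarrow>\<^sub>0 int) monoid" where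
  "free M \<equiv> tensor_free B M"

abbreviation rel :: "('a, 'v) module \<Rightarrow> ('b \<times> 'v \<Rightarrow>\<^sub>0 int) set" where
  "rel M \<equiv> tensor_rel B q A M"

abbreviation ext :: "('a, 'v) module \<Rightarrow> ('b, ('b \<times> 'v \<Rightarrow>\<^sub>0 int) set) module" where
  "ext M \<equiv> tensor_mod B q A M"

text \<open>The three families of relations that define the tensor product.\<close>

definition gens :: "('a, 'v) module \<Rightarrow> ('b \<times> 'v \<Rightarrow>\<^sub>0 int) set" where
  "gens M =
     {frag_of (b \<oplus>\<^bsub>B\<^esub> b', x) - frag_of (b, x) - frag_of (b', x) |b b' x.
         b \<in> carrier B \<and> b' \<in> carrier B \<and> x \<in> carrier M} \<union>
     {frag_of (b, x \<oplus>\<^bsub>M\<^esub> x') - frag_of (b, x) - frag_of (b, x') |b x x'.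
         b \<in> carrier B \<and> x \<in> carrier M \<and> x' \<in> carrier M} \<union>
     {frag_of (b \<otimes>\<^bsub>B\<^esub> q a, x) - frag_of (b, a \<odot>\<^bsub>M\<^esub> x) |b a x.
         b \<in> carrier B \<and> a \<in> carrier A \<and> x \<in> carrier M}"

lemma rel_eq: "rel M = generate (free M) (gens M)"
  by (simp add: tensor_rel_def gens_def)

text \<open>The class in \<open>B \<otimes> M\<close> of a formal integral combination of pairs.\<close>

definition cls :: "('a, 'v) module \<Rightarrow> ('b \<times> 'v \<Rightarrow>\<^sub>0 int) \<Rightarrow> ('b \<times> 'v \<Rightarrow>\<^sub>0 int) set" where
  "cls M z = rel M #>\<^bsub>free M\<^esub> z"

text \<open>The elementary tensor \<open>b \<otimes> x\<close>.\<close>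

definition pure :: "('a, 'v) module \<Rightarrow> 'b \<Rightarrow> 'v \<Rightarrow> ('b \<times> 'v \<Rightarrow>\<^sub>0 int) set" where
  "pure M b x = cls M (frag_of (b, x))"

lemma carrier_free: "z \<in> carrier (free M) \<longleftrightarrow> Poly_Mapping.keys z \<subseteq> carrier B \<times> carrier M"
  by (simp add: tensor_free_def)

lemma frag_of_free: "frag_of (b, x) \<in> carrier (free M) \<longleftrightarrow> b \<in> carrier B \<and> x \<in> carrier M"
  by (simp add: carrier_free)

lemma free_simps: "z \<otimes>\<^bsub>free M\<^esub> w = z + w" "\<one>\<^bsub>free M\<^esub> = 0"
  by (simp_all add: tensor_free_def)

lemma free_inv: "z \<in> carrier (free M) \<Longrightarrow> inv\<^bsub>free M\<^esub> z = - z"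
  by (simp add: tensor_free_def)

lemma comm_group_free: "comm_group (free M)"
  by (simp add: tensor_free_def abelian_free_Abelian_group)

lemma group_free: "group (free M)"
  by (rule comm_group.axioms(2)[OF comm_group_free])

lemma free_diff:
  "\<lbrakk>z \<in> carrier (free M); w \<in> carrier (free M)\<rbrakk> \<Longrightarrow> z - w \<in> carrier (free M)"
  unfolding carrier_free using keys_diff[of z w] by blast

lemma free_add:
  "\<lbrakk>z \<in> carrier (free M); w \<in> carrier (free M)\<rbrakk> \<Longrightarrow> z + w \<in> carrier (free M)"
  unfolding carrier_free using Poly_Mapping.keys_add[of z w] by blast

lemma free_minus: "z \<in> carrier (free M) \<Longrightarrow> - z \<in> carrier (free M)"
  by (simp add: carrier_free)

lemma gens_subset:
  assumes "left_module A M"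
  shows "gens M \<subseteq> carrier (free M)"
proof -
  interpret M: left_module A M by fact
  show ?thesis
    by (auto simp: gens_def frag_of_free q_closed M.smult_closed intro!: free_diff)
qed

lemma subgroup_rel:
  assumes "left_module A M"
  shows "subgroup (rel M) (free M)"
  unfolding rel_eq by (rule group.generate_is_subgroup[OF group_free gens_subset[OF assms]])

lemma rel_induct [consumes 2, case_names zero gen minus add]:
  assumes "left_module A M" and z: "z \<in> rel M"
    and zero: "Pr 0"
    and gen: "\<And>g. g \<in> gens M \<Longrightarrow> Pr g"
    and minus: "\<And>z. \<lbrakk>z \<in> carrier (free M); Pr z\<rbrakk> \<Longrightarrow> Pr (- z)"
    and add: "\<And>z w. \<lbrakk>z \<in> carrier (free M); w \<in> carrier (free M); Pr z; Pr w\<rbrakk> \<Longrightarrow> Pr (z + w)"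
  shows "Pr z"
  using z unfolding rel_eq
proof (induction rule: generate.induct)
  case one
  show ?case using zero by (simp add: free_simps)
next
  case (incl h)
  then show ?case by (rule gen)
next
  case (inv h)
  then show ?case
    using gens_subset[OF assms(1)] gen minus by (auto simp: free_inv)
next
  case (eng z w)
  moreover from this have "z \<in> carrier (free M)" "w \<in> carrier (free M)"
    using group.generate_in_carrier[OF group_free gens_subset[OF assms(1)]] by auto
  ultimately show ?case using add by (simp add: free_simps)
qed

lemma cls_eqI:
  assumes "left_module A M" "w \<in> carrier (free M)" "z - w \<in> rel M"
  shows "cls M z = cls M w"
proof -
  have "z \<in> cls M w"
    using assms(3) unfolding cls_def r_coset_def by (force simp: free_simps)
  then show ?thesis
    using group.repr_independence[OF group_free _ assms(2) subgroup_rel[OF assms(1)]]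
    unfolding cls_def by metis
qed

lemma cls_memD:
  assumes "z \<in> cls M w"
  shows "z - w \<in> rel M"
  using assms by (auto simp: cls_def r_coset_def free_simps)

lemma cls_self:
  assumes "left_module A M" "z \<in> carrier (free M)"
  shows "z \<in> cls M z"
  unfolding cls_def by (rule group.rcos_self[OF group_free assms(2) subgroup_rel[OF assms(1)]])

lemma abelian_group_ext:
  assumes "left_module A M"
  shows "abelian_group (ext M)"
  by (rule abelian_group_of_comm_group[OF comm_group.abelian_FactGroup[OF comm_group_free
          subgroup_rel[OF assms]]])
    (simp_all add: tensor_mod_def mk_mod_def FactGroup_def)

lemma carrier_ext: "carrier (ext M) = cls M ` carrier (free M)"
  by (auto simp: tensor_mod_def mk_mod_def FactGroup_def RCOSETS_def cls_def)

lemma zero_ext: "\<zero>\<^bsub>ext M\<^esub> = cls M 0"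
  by (simp add: tensor_mod_def mk_mod_def cls_def r_coset_def free_simps)

lemma add_ext:
  assumes "left_module A M" "z \<in> carrier (free M)" "w \<in> carrier (free M)"
  shows "cls M z \<oplus>\<^bsub>ext M\<^esub> cls M w = cls M (z + w)"
proof -
  have "rel M \<lhd> free M"
    by (rule comm_group.subgroup_imp_normal[OF comm_group_free subgroup_rel[OF assms(1)]])
  then show ?thesis
    using normal.rcos_sum[of "rel M" "free M" z w] assms(2,3)
    by (simp add: tensor_mod_def mk_mod_def FactGroup_def cls_def free_simps)
qed

lemma frag_extend_free:
  assumes "\<And>b x. \<lbrakk>b \<in> carrier B; x \<in> carrier M\<rbrakk> \<Longrightarrow> \<phi> (b, x) \<in> carrier (free N)"
    and "z \<in> carrier (free M)"
  shows "frag_extend \<phi> z \<in> carrier (free N)"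
proof -
  have "Poly_Mapping.keys (\<phi> p) \<subseteq> carrier B \<times> carrier N" if "p \<in> Poly_Mapping.keys z" for p
    using that assms unfolding carrier_free by (cases p) blast
  then show ?thesis
    unfolding carrier_free using keys_frag_extend[of \<phi> z] by blast
qed

text \<open>A map of the free groups that respects the relations passes to the classes, in the form of the
  unions by which \<open>tensor_mod\<close> and \<open>tensor_map\<close> are defined.\<close>

lemma frag_extend_cls:
  assumes M: "left_module A M" and N: "left_module A N"
    and cl: "\<And>b x. \<lbrakk>b \<in> carrier B; x \<in> carrier M\<rbrakk> \<Longrightarrow> \<phi> (b, x) \<in> carrier (free N)"
    and gen: "\<And>g. g \<in> gens M \<Longrightarrow> frag_extend \<phi> g \<in> rel N"
    and z: "z \<in> carrier (free M)"
  shows "(\<Union>w\<in>cls M z. rel N #>\<^bsub>free N\<^esub> frag_extend \<phi> w) = cls N (frag_extend \<phi> z)"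
proof -
  interpret rel: subgroup "rel N" "free N"
    by (rule subgroup_rel[OF N])
  have rel: "frag_extend \<phi> r \<in> rel N" if "r \<in> rel M" for r
    using M that
  proof (induction rule: rel_induct)
    case zero
    then show ?case using rel.one_closed by (simp add: free_simps)
  next
    case (gen g)
    then show ?case by (rule assms(4))
  next
    case (minus z)
    then show ?case
      using rel.m_inv_closed[OF minus.IH] free_inv[OF rel.mem_carrier[OF minus.IH]]
      by (simp add: frag_extend_minus)
  next
    case (add z w)
    then show ?case
      using rel.m_closed[of "frag_extend \<phi> z" "frag_extend \<phi> w"]
      by (simp add: frag_extend_add free_simps)
  qed
  have "cls N (frag_extend \<phi> w) = cls N (frag_extend \<phi> z)" if "w \<in> cls M z" for w
    using rel[OF cls_memD[OF that]] frag_extend_free[of M \<phi> N z, OF cl z]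
    by (intro cls_eqI[OF N]) (simp_all add: frag_extend_diff)
  then show ?thesis
    using cls_self[OF M z] unfolding cls_def by blast
qed

lemma pure_closed:
  "\<lbrakk>b \<in> carrier B; x \<in> carrier M\<rbrakk> \<Longrightarrow> pure M b x \<in> carrier (ext M)"
  by (auto simp: pure_def carrier_ext frag_of_free)

lemma gens_rel: "g \<in> gens M \<Longrightarrow> g \<in> rel M"
  unfolding rel_eq by (rule generate.incl)

lemma pure_add_left:
  assumes "left_module A M" "b \<in> carrier B" "b' \<in> carrier B" "x \<in> carrier M"
  shows "pure M (b \<oplus>\<^bsub>B\<^esub> b') x = pure M b x \<oplus>\<^bsub>ext M\<^esub> pure M b' x"
proof -
  have "frag_of (b \<oplus>\<^bsub>B\<^esub> b', x) - frag_of (b, x) - frag_of (b', x) \<in> gens M"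
    using assms unfolding gens_def by blast
  then have "frag_of (b \<oplus>\<^bsub>B\<^esub> b', x) - (frag_of (b, x) + frag_of (b', x)) \<in> rel M"
    using gens_rel by (simp add: diff_diff_eq)
  moreover have "cls M (frag_of (b, x)) \<oplus>\<^bsub>ext M\<^esub> cls M (frag_of (b', x)) =
      cls M (frag_of (b, x) + frag_of (b', x))"
    using assms by (intro add_ext) (simp_all add: frag_of_free)
  ultimately show ?thesis
    using assms unfolding pure_def by (simp add: cls_eqI frag_of_free free_add)
qed

lemma pure_add_right:
  assumes "left_module A M" "b \<in> carrier B" "x \<in> carrier M" "x' \<in> carrier M"
  shows "pure M b (x \<oplus>\<^bsub>M\<^esub> x') = pure M b x \<oplus>\<^bsub>ext M\<^esub> pure M b x'"
proof -
  have "frag_of (b, x \<oplus>\<^bsub>M\<^esub> x') - frag_of (b, x) - frag_of (b, x') \<in> gens M"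
    using assms unfolding gens_def by blast
  then have "frag_of (b, x \<oplus>\<^bsub>M\<^esub> x') - (frag_of (b, x) + frag_of (b, x')) \<in> rel M"
    using gens_rel by (simp add: diff_diff_eq)
  moreover have "cls M (frag_of (b, x)) \<oplus>\<^bsub>ext M\<^esub> cls M (frag_of (b, x')) =
      cls M (frag_of (b, x) + frag_of (b, x'))"
    using assms by (intro add_ext) (simp_all add: frag_of_free)
  ultimately show ?thesis
    using assms unfolding pure_def by (simp add: cls_eqI frag_of_free free_add)
qed

lemma pure_balanced:
  assumes "left_module A M" "b \<in> carrier B" "a \<in> carrier A" "x \<in> carrier M"
  shows "pure M (b \<otimes>\<^bsub>B\<^esub> q a) x = pure M b (a \<odot>\<^bsub>M\<^esub> x)"
proof -
  interpret M: left_module A M by fact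
  have "frag_of (b \<otimes>\<^bsub>B\<^esub> q a, x) - frag_of (b, a \<odot>\<^bsub>M\<^esub> x) \<in> gens M"
    using assms unfolding gens_def by blast
  then show ?thesis
    using assms gens_rel unfolding pure_def
    by (intro cls_eqI) (auto simp: frag_of_free M.smult_closed)
qed

lemma smult_pure:
  assumes "left_module A M" "b \<in> carrier B" "b' \<in> carrier B" "x \<in> carrier M"
  shows "b \<odot>\<^bsub>ext M\<^esub> pure M b' x = pure M (b \<otimes>\<^bsub>B\<^esub> b') x"
proof -
  let ?\<phi> = "\<lambda>(b', x). frag_of (b \<otimes>\<^bsub>B\<^esub> b', x)"
  have "frag_extend ?\<phi> g \<in> gens M" if "g \<in> gens M" for g
    using that unfolding gens_def
  proof (elim UnE CollectE exE conjE, goal_cases)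
    case (1 b1 b2 x)
    then have "frag_extend ?\<phi> g = frag_of (b \<otimes>\<^bsub>B\<^esub> b1 \<oplus>\<^bsub>B\<^esub> b \<otimes>\<^bsub>B\<^esub> b2, x) -
        frag_of (b \<otimes>\<^bsub>B\<^esub> b1, x) - frag_of (b \<otimes>\<^bsub>B\<^esub> b2, x)"
      using assms(2) by (simp add: frag_extend_diff B.r_distr)
    moreover have "b \<otimes>\<^bsub>B\<^esub> b1 \<in> carrier B" "b \<otimes>\<^bsub>B\<^esub> b2 \<in> carrier B"
      using 1 assms(2) by simp_all
    ultimately show ?case using 1 by blast
  next
    case (2 c y y')
    then have "frag_extend ?\<phi> g = frag_of (b \<otimes>\<^bsub>B\<^esub> c, y \<oplus>\<^bsub>M\<^esub> y') -
        frag_of (b \<otimes>\<^bsub>B\<^esub> c, y) - frag_of (b \<otimes>\<^bsub>B\<^esub> c, y')"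
      by (simp add: frag_extend_diff)
    moreover have "b \<otimes>\<^bsub>B\<^esub> c \<in> carrier B"
      using 2 assms(2) by simp
    ultimately show ?case using 2 by blast
  next
    case (3 c a y)
    then have "frag_extend ?\<phi> g = frag_of ((b \<otimes>\<^bsub>B\<^esub> c) \<otimes>\<^bsub>B\<^esub> q a, y) -
        frag_of (b \<otimes>\<^bsub>B\<^esub> c, a \<odot>\<^bsub>M\<^esub> y)"
      using assms(2) by (simp add: frag_extend_diff B.m_assoc q_closed)
    moreover have "b \<otimes>\<^bsub>B\<^esub> c \<in> carrier B"
      using 3 assms(2) by simp
    ultimately show ?case using 3 by blast
  qed
  then have "(\<Union>w\<in>cls M (frag_of (b', x)). rel M #>\<^bsub>free M\<^esub> frag_extend ?\<phi> w) =
      cls M (frag_extend ?\<phi> (frag_of (b', x)))"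
    using assms gens_rel by (intro frag_extend_cls) (auto simp: frag_of_free)
  then show ?thesis
    by (simp add: tensor_mod_def mk_mod_def pure_def)
qed

lemma tensor_map_pure:
  assumes "left_module A M" "left_module A N" and f: "f \<in> mod_hom A M N"
    and "b \<in> carrier B" "x \<in> carrier M"
  shows "tensor_map B q A N f (pure M b x) = pure N b (f x)"
proof -
  let ?\<phi> = "\<lambda>(b, x). frag_of (b, f x)"
  note f_closed = mod_hom_closed[OF f]
  have "frag_extend ?\<phi> g \<in> gens N" if "g \<in> gens M" for g
    using that unfolding gens_def
  proof (elim UnE CollectE exE conjE, goal_cases)
    case (1 b1 b2 x)
    then have "frag_extend ?\<phi> g = frag_of (b1 \<oplus>\<^bsub>B\<^esub> b2, f x) - frag_of (b1, f x) - frag_of (b2, f x)"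
      by (simp add: frag_extend_diff)
    then show ?case using 1 f_closed by blast
  next
    case (2 c y y')
    then have "frag_extend ?\<phi> g = frag_of (c, f y \<oplus>\<^bsub>N\<^esub> f y') - frag_of (c, f y) - frag_of (c, f y')"
      by (simp add: frag_extend_diff mod_hom_add[OF f])
    then show ?case using 2 f_closed by blast
  next
    case (3 c a y)
    then have "frag_extend ?\<phi> g = frag_of (c \<otimes>\<^bsub>B\<^esub> q a, f y) - frag_of (c, a \<odot>\<^bsub>N\<^esub> f y)"
      by (simp add: frag_extend_diff mod_hom_smult[OF f])
    then show ?case using 3 f_closed by blast
  qed
  then have "(\<Union>w\<in>cls M (frag_of (b, x)). rel N #>\<^bsub>free N\<^esub> frag_extend ?\<phi> w) =
      cls N (frag_extend ?\<phi> (frag_of (b, x)))"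
    using assms gens_rel f_closed by (intro frag_extend_cls) (auto simp: frag_of_free)
  then show ?thesis
    by (simp add: tensor_map_def pure_def)
qed

text \<open>The existence half of the universal property: a balanced map \<open>\<beta>\<close> on pairs induces an additive map
  \<open>\<psi>\<close> on \<open>B \<otimes> M\<close>.\<close>

lemma ext_universal:
  assumes M: "left_module A M" and N: "abelian_group N"
    and cl: "\<And>b x. \<lbrakk>b \<in> carrier B; x \<in> carrier M\<rbrakk> \<Longrightarrow> \<beta> b x \<in> carrier N"
    and add_left: "\<And>b b' x. \<lbrakk>b \<in> carrier B; b' \<in> carrier B; x \<in> carrier M\<rbrakk> \<Longrightarrow>
      \<beta> (b \<oplus>\<^bsub>B\<^esub> b') x = \<beta> b x \<oplus>\<^bsub>N\<^esub> \<beta> b' x"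
    and add_right: "\<And>b x x'. \<lbrakk>b \<in> carrier B; x \<in> carrier M; x' \<in> carrier M\<rbrakk> \<Longrightarrow>
      \<beta> b (x \<oplus>\<^bsub>M\<^esub> x') = \<beta> b x \<oplus>\<^bsub>N\<^esub> \<beta> b x'"
    and balanced: "\<And>b a x. \<lbrakk>b \<in> carrier B; a \<in> carrier A; x \<in> carrier M\<rbrakk> \<Longrightarrow>
      \<beta> (b \<otimes>\<^bsub>B\<^esub> q a) x = \<beta> b (a \<odot>\<^bsub>M\<^esub> x)"
  obtains \<psi> where "\<And>b x. \<lbrakk>b \<in> carrier B; x \<in> carrier M\<rbrakk> \<Longrightarrow> \<psi> (pure M b x) = \<beta> b x"
    and "\<And>U V. \<lbrakk>U \<in> carrier (ext M); V \<in> carrier (ext M)\<rbrakk> \<Longrightarrow> \<psi> (U \<oplus>\<^bsub>ext M\<^esub> V) = \<psi> U \<oplus>\<^bsub>N\<^esub> \<psi> V"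
proof -
  interpret M: left_module A M by fact
  interpret N: abelian_group N by fact
  have "(\<lambda>(b, x). \<beta> b x) ` (carrier B \<times> carrier M) \<subseteq> carrier (add_monoid N)"
    using cl by auto
  then obtain h where h: "h \<in> hom (free M) (add_monoid N)"
    and h_frag: "\<And>p. p \<in> carrier B \<times> carrier M \<Longrightarrow> h (frag_of p) = (\<lambda>(b, x). \<beta> b x) p"
    using comm_group.free_Abelian_group_universal[OF N.a_comm_group]
    unfolding tensor_free_def by metis
  interpret h: group_hom "free M" "add_monoid N" h
    using h group_free N.a_group by (simp add: group_hom_def group_hom_axioms_def)
  have h_diff: "h (z - w) = h z \<ominus>\<^bsub>N\<^esub> h w" if "z \<in> carrier (free M)" "w \<in> carrier (free M)" for z w
    using h.hom_mult[of z "- w"] h.hom_inv[of w] that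
    by (simp add: free_simps free_inv free_minus a_minus_def a_inv_def)
  have h_add: "h (z + w) = h z \<oplus>\<^bsub>N\<^esub> h w" if "z \<in> carrier (free M)" "w \<in> carrier (free M)" for z w
    using h.hom_mult[of z w] that by (simp add: free_simps)
  have h_closed: "h z \<in> carrier N" if "z \<in> carrier (free M)" for z
    using h.hom_closed[OF that] by simp
  have cancel: "(u \<oplus>\<^bsub>N\<^esub> v) \<ominus>\<^bsub>N\<^esub> u \<ominus>\<^bsub>N\<^esub> v = \<zero>\<^bsub>N\<^esub>" if "u \<in> carrier N" "v \<in> carrier N" for u v
    unfolding N.a_comm[OF that] using that by (simp add: N.minus_eq N.a_assoc N.r_neg)
  have h_gens: "h g = \<zero>\<^bsub>N\<^esub>" if "g \<in> gens M" for g
    using that unfolding gens_def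
  proof (elim UnE CollectE exE conjE, goal_cases)
    case (1 b b' x)
    then show ?case
      by (simp add: h_diff free_diff frag_of_free h_frag add_left cl cancel)
  next
    case (2 b x x')
    then show ?case
      by (simp add: h_diff free_diff frag_of_free h_frag add_right cl cancel)
  next
    case (3 b a x)
    then show ?case
      by (simp add: h_diff frag_of_free h_frag balanced cl N.minus_eq N.r_neg q_closed M.smult_closed)
  qed
  have h_rel: "h r = \<zero>\<^bsub>N\<^esub>" if "r \<in> rel M" for r
    using M that
  proof (induction rule: rel_induct)
    case zero
    then show ?case using h.hom_one by (simp add: free_simps)
  next
    case (gen g)
    then show ?case by (rule h_gens)
  next
    case (minus z)
    then show ?case using h.hom_inv[of z] N.add.inv_one by (simp add: free_inv)
  next
    case (add z w)
    then show ?case by (simp add: h_add)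
  qed
  define \<psi> where "\<psi> U = h (SOME z. z \<in> U)" for U
  have \<psi>: "\<psi> (cls M z) = h z" if z: "z \<in> carrier (free M)" for z
  proof -
    define w where "w = (SOME w. w \<in> cls M z)"
    have "w \<in> cls M z"
      unfolding w_def by (rule someI[of "\<lambda>w. w \<in> cls M z", OF cls_self[OF M z]])
    then have r: "w - z \<in> rel M" by (rule cls_memD)
    then have "w - z \<in> carrier (free M)"
      using subgroup.mem_carrier[OF subgroup_rel[OF M]] by blast
    then have "h (w - z + z) = h z"
      using h_add[of "w - z" z] z h_rel[OF r] h_closed by simp
    then show ?thesis
      by (simp add: \<psi>_def w_def)
  qed
  show thesis
  proof (rule that)
    show "\<psi> (pure M b x) = \<beta> b x" if "b \<in> carrier B" "x \<in> carrier M" for b x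
      using that by (simp add: pure_def \<psi> frag_of_free h_frag)
    show "\<psi> (U \<oplus>\<^bsub>ext M\<^esub> V) = \<psi> U \<oplus>\<^bsub>N\<^esub> \<psi> V"
      if U: "U \<in> carrier (ext M)" and V: "V \<in> carrier (ext M)" for U V
    proof -
      obtain z w where zw: "z \<in> carrier (free M)" "U = cls M z" "w \<in> carrier (free M)" "V = cls M w"
        using U V by (auto simp: carrier_ext)
      moreover have "z + w \<in> carrier (free M)"
        using zw(1,3) by (rule free_add)
      ultimately show ?thesis
        by (simp add: add_ext[OF M] \<psi> h_add)
    qed
  qed
qed

text \<open>If \<open>q\<close> is onto, then every element of \<open>B \<otimes> M\<close> is an elementary tensor \<open>1 \<otimes> x\<close>.\<close>

lemma carrier_ext_surj:
  assumes M: "left_module A M" and surj: "q ` carrier A = carrier B"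
  shows "carrier (ext M) = pure M \<one>\<^bsub>B\<^esub> ` carrier M"
proof -
  interpret M: left_module A M by fact
  interpret ext: abelian_group "ext M" by (rule abelian_group_ext[OF M])
  have group: "group_hom (add_monoid M) (add_monoid (ext M)) (pure M \<one>\<^bsub>B\<^esub>)"
    using M.M.a_group ext.a_group
    by (auto simp: group_hom_def group_hom_axioms_def hom_def pure_closed pure_add_right[OF M])
  interpret p: group_hom "add_monoid M" "add_monoid (ext M)" "pure M \<one>\<^bsub>B\<^esub>"
    by (rule group)
  have "cls M z \<in> pure M \<one>\<^bsub>B\<^esub> ` carrier M"
    if "Poly_Mapping.keys z \<subseteq> carrier B \<times> carrier M" for z
    using that
  proof (induction rule: free_Abelian_group_induct[consumes 1, case_names zero diff frag])
    case zero
    show ?case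
      using p.hom_one M.M.zero_closed by (auto simp: zero_ext intro: rev_image_eqI)
  next
    case (diff z w)
    then obtain x y where x: "x \<in> carrier M" "cls M z = pure M \<one>\<^bsub>B\<^esub> x"
      and y: "y \<in> carrier M" "cls M w = pure M \<one>\<^bsub>B\<^esub> y"
      by blast
    have "cls M z = cls M (z - w) \<oplus>\<^bsub>ext M\<^esub> cls M w"
      using diff(1,2) free_diff[of z M w] by (subst add_ext[OF M]) (simp_all add: carrier_free)
    moreover have "pure M \<one>\<^bsub>B\<^esub> x = pure M \<one>\<^bsub>B\<^esub> (x \<ominus>\<^bsub>M\<^esub> y) \<oplus>\<^bsub>ext M\<^esub> pure M \<one>\<^bsub>B\<^esub> y"
      using x(1) y(1) by (simp add: M.M.minus_eq M.M.a_assoc M.M.l_neg flip: pure_add_right[OF M])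
    ultimately have "cls M (z - w) = pure M \<one>\<^bsub>B\<^esub> (x \<ominus>\<^bsub>M\<^esub> y)"
      using x y diff(1,2) free_diff[of z M w] pure_closed[of "\<one>\<^bsub>B\<^esub>" _ M]
      by (subst ext.add.right_cancel[of "cls M w", symmetric]) (auto simp: carrier_ext carrier_free)
    then show ?case using x(1) y(1) by blast
  next
    case (frag p)
    then obtain a x where a: "a \<in> carrier A" "x \<in> carrier M" "p = (q a, x)"
      using surj[symmetric] by auto
    then have "pure M \<one>\<^bsub>B\<^esub> (a \<odot>\<^bsub>M\<^esub> x) = cls M (frag_of p)"
      using pure_balanced[OF M B.one_closed a(1,2)] q_closed[OF a(1)] by (simp add: pure_def)
    then show ?case
      using a M.smult_closed by (metis imageI)
  qed
  then show ?thesis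
    using pure_closed[OF B.one_closed] by (auto simp: carrier_ext carrier_free)
qed

end


section \<open>Right exactness of the reduction\<close>

lemma scalar_extension_quot:
  assumes "ring A" "ideal I A"
  shows "scalar_extension A (quot_algebra A I) ((+>\<^bsub>A\<^esub>) I)"
  by (intro scalar_extension.intro scalar_extension_axioms.intro assms(1)
      ring_quot_algebra[OF assms(2)] quot_algebra_hom[OF assms(2)])

text \<open>Extension of scalars to \<open>A/I\<close> sends an exact sequence \<open>W \<rightarrow> Y \<rightarrow> M \<rightarrow> 0\<close> to an exact sequence that ends
  in \<open>M / I M\<close>, which takes the place of \<open>A/I \<otimes> M\<close>.\<close>

lemma is_cokernel_ext:
  fixes A :: "('k, 'a) module" and W :: "('a, 'u) module" and Y :: "('a, 'v) module"
    and M :: "('a, 'w) module"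
  assumes W: "left_module A W" and Y: "left_module A Y" and M: "left_module A M"
    and I: "ideal I A" and d: "d \<in> mod_hom A W Y" and cok: "is_cokernel A W d Y M r"
  shows "\<exists>s. is_cokernel (quot_algebra A I)
    (tensor_mod (quot_algebra A I) (\<lambda>a. I +>\<^bsub>A\<^esub> a) A W)
    (tensor_map (quot_algebra A I) (\<lambda>a. I +>\<^bsub>A\<^esub> a) A Y d)
    (tensor_mod (quot_algebra A I) (\<lambda>a. I +>\<^bsub>A\<^esub> a) A Y) (reduced_mod I M) s"
proof -
  let ?B = "quot_algebra A I" and ?R = "reduced_mod I M"
  interpret W: left_module A W by fact
  interpret Y: left_module A Y by fact
  interpret M: left_module A M by fact
  interpret I: ideal I A by fact
  interpret scalar_extension A ?B "(+>\<^bsub>A\<^esub>) I"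
    by (rule scalar_extension_quot[OF ideal.axioms(2)[OF I] I])
  interpret R: left_module ?B ?R
    by (rule left_module_reduced_mod[OF M I])
  interpret E: abelian_group "ext Y"
    by (rule abelian_group_ext[OF Y])
  have r: "r \<in> mod_hom A Y M" "r ` carrier Y = carrier M"
    and ker: "{y \<in> carrier Y. r y = \<zero>\<^bsub>M\<^esub>} = d ` carrier W"
    using cok by (auto simp: is_cokernel_def)
  note surj = quot_algebra_surj[symmetric, of A I]
  define red where "red y = ideal_smult I M +>\<^bsub>M\<^esub> r y" for y
  have red_closed: "red y \<in> carrier ?R" if "y \<in> carrier Y" for y
    using mod_hom_closed[OF r(1) that] by (auto simp: red_def reduced_mod_simps)
  have red_add: "red (x \<oplus>\<^bsub>Y\<^esub> y) = red x \<oplus>\<^bsub>?R\<^esub> red y" if "x \<in> carrier Y" "y \<in> carrier Y" for x y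
    using that mod_hom_closed[OF r(1)]
    by (simp add: red_def mod_hom_add[OF r(1)] reduced_mod_add[OF M I])
  have red_smult: "red (a \<odot>\<^bsub>Y\<^esub> y) = (I +>\<^bsub>A\<^esub> a) \<odot>\<^bsub>?R\<^esub> red y"
    if "a \<in> carrier A" "y \<in> carrier Y" for a y
    using that mod_hom_closed[OF r(1)]
    by (simp add: red_def mod_hom_smult[OF r(1)] reduced_mod_smult[OF M I])
  obtain \<psi> where \<psi>: "\<And>b y. \<lbrakk>b \<in> carrier ?B; y \<in> carrier Y\<rbrakk> \<Longrightarrow> \<psi> (pure Y b y) = b \<odot>\<^bsub>?R\<^esub> red y"
    and \<psi>_add: "\<And>U V. \<lbrakk>U \<in> carrier (ext Y); V \<in> carrier (ext Y)\<rbrakk> \<Longrightarrow>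
      \<psi> (U \<oplus>\<^bsub>ext Y\<^esub> V) = \<psi> U \<oplus>\<^bsub>?R\<^esub> \<psi> V"
  proof (rule ext_universal[OF Y R.M.abelian_group_axioms, of "\<lambda>b y. b \<odot>\<^bsub>?R\<^esub> red y"])
    show "b \<odot>\<^bsub>?R\<^esub> red y \<in> carrier ?R" if "b \<in> carrier ?B" "y \<in> carrier Y" for b y
      using that by (simp add: R.smult_closed red_closed)
    show "(b \<oplus>\<^bsub>?B\<^esub> b') \<odot>\<^bsub>?R\<^esub> red y = b \<odot>\<^bsub>?R\<^esub> red y \<oplus>\<^bsub>?R\<^esub> b' \<odot>\<^bsub>?R\<^esub> red y"
      if "b \<in> carrier ?B" "b' \<in> carrier ?B" "y \<in> carrier Y" for b b' y
      using that by (simp add: R.smult_l_distr red_closed)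
    show "b \<odot>\<^bsub>?R\<^esub> red (x \<oplus>\<^bsub>Y\<^esub> y) = b \<odot>\<^bsub>?R\<^esub> red x \<oplus>\<^bsub>?R\<^esub> b \<odot>\<^bsub>?R\<^esub> red y"
      if "b \<in> carrier ?B" "x \<in> carrier Y" "y \<in> carrier Y" for b x y
      using that by (simp add: red_add R.smult_r_distr red_closed)
    show "(b \<otimes>\<^bsub>?B\<^esub> (I +>\<^bsub>A\<^esub> a)) \<odot>\<^bsub>?R\<^esub> red y = b \<odot>\<^bsub>?R\<^esub> red (a \<odot>\<^bsub>Y\<^esub> y)"
      if "b \<in> carrier ?B" "a \<in> carrier A" "y \<in> carrier Y" for b a y
      using that by (simp add: red_smult R.smult_assoc1 red_closed q_closed)
  qed blast
  have \<psi>_one: "\<psi> (pure Y \<one>\<^bsub>?B\<^esub> y) = red y" if "y \<in> carrier Y" for y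
    using that by (simp add: \<psi> R.smult_one red_closed)
  have elem: "carrier (ext Y) = pure Y \<one>\<^bsub>?B\<^esub> ` carrier Y"
    "carrier (ext W) = pure W \<one>\<^bsub>?B\<^esub> ` carrier W"
    using carrier_ext_surj[OF Y surj] carrier_ext_surj[OF W surj] by simp_all
  have one_smult: "pure Y (I +>\<^bsub>A\<^esub> a) y = pure Y \<one>\<^bsub>?B\<^esub> (a \<odot>\<^bsub>Y\<^esub> y)"
    if "a \<in> carrier A" "y \<in> carrier Y" for a y
    using pure_balanced[OF Y B.one_closed that] q_closed[OF that(1)] by simp
  have \<psi>_hom: "\<psi> \<in> mod_hom ?B (ext Y) ?R"
  proof (rule mod_homI)
    show "\<psi> U \<in> carrier ?R" if "U \<in> carrier (ext Y)" for U
      using that by (auto simp: elem \<psi>_one red_closed)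
    show "\<psi> (U \<oplus>\<^bsub>ext Y\<^esub> V) = \<psi> U \<oplus>\<^bsub>?R\<^esub> \<psi> V" if "U \<in> carrier (ext Y)" "V \<in> carrier (ext Y)" for U V
      using that by (rule \<psi>_add)
    show "\<psi> (b \<odot>\<^bsub>ext Y\<^esub> U) = b \<odot>\<^bsub>?R\<^esub> \<psi> U" if "b \<in> carrier ?B" "U \<in> carrier (ext Y)" for b U
      using that by (auto simp: elem \<psi> smult_pure[OF Y] R.smult_one red_closed)
  qed
  have \<psi>_surj: "\<psi> ` carrier (ext Y) = carrier ?R"
  proof -
    have "\<psi> ` carrier (ext Y) = red ` carrier Y"
      by (simp add: elem image_image \<psi>_one cong: image_cong)
    also have "\<dots> = (\<lambda>m. ideal_smult I M +>\<^bsub>M\<^esub> m) ` r ` carrier Y"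
      by (simp add: red_def image_image)
    finally show ?thesis
      by (simp add: r(2) reduced_mod_simps)
  qed
  have one_add: "pure Y \<one>\<^bsub>?B\<^esub> (x \<oplus>\<^bsub>Y\<^esub> y) = pure Y \<one>\<^bsub>?B\<^esub> x \<oplus>\<^bsub>ext Y\<^esub> pure Y \<one>\<^bsub>?B\<^esub> y"
    if "x \<in> carrier Y" "y \<in> carrier Y" for x y
    using that by (intro pure_add_right[OF Y]) simp_all
  interpret p: group_hom "add_monoid Y" "add_monoid (ext Y)" "pure Y \<one>\<^bsub>?B\<^esub>"
    using Y.M.a_group E.a_group one_add
    by (auto simp: group_hom_def group_hom_axioms_def hom_def pure_closed)
  \<comment> \<open>\<open>1 \<otimes> i y = i \<otimes> y = 0\<close> for \<open>i \<in> I\<close>.\<close>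
  have pure_I: "pure Y \<one>\<^bsub>?B\<^esub> y = \<zero>\<^bsub>ext Y\<^esub>" if "y \<in> ideal_smult I Y" for y
    using that
  proof (induction rule: ideal_smult_induct[OF Y I, consumes 1, case_names zero smult minus add])
    case zero
    then show ?case using p.hom_one by simp
  next
    case (smult i y)
    have "I +>\<^bsub>A\<^esub> i = \<zero>\<^bsub>?B\<^esub>"
      using I.a_rcos_const[OF smult(1)] by (simp add: quot_algebra_simps)
    then have "pure Y \<one>\<^bsub>?B\<^esub> (i \<odot>\<^bsub>Y\<^esub> y) = pure Y \<zero>\<^bsub>?B\<^esub> y"
      using one_smult[OF I.Icarr[OF smult(1)] smult(2)] by simp
    moreover have "pure Y \<zero>\<^bsub>?B\<^esub> y = pure Y \<zero>\<^bsub>?B\<^esub> y \<oplus>\<^bsub>ext Y\<^esub> pure Y \<zero>\<^bsub>?B\<^esub> y"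
      using pure_add_left[OF Y B.zero_closed B.zero_closed smult(2)] by simp
    ultimately show ?case
      using pure_closed[OF B.zero_closed smult(2)] E.add.r_cancel_one' by metis
  next
    case (minus y)
    then show ?case using p.hom_inv[of y] E.add.inv_one by (simp add: a_inv_def)
  next
    case (add x y)
    then show ?case by (simp add: one_add)
  qed
  have image: "tensor_map ?B ((+>\<^bsub>A\<^esub>) I) A Y d ` carrier (ext W) =
      (\<lambda>w. pure Y \<one>\<^bsub>?B\<^esub> (d w)) ` carrier W"
    by (simp add: elem image_image tensor_map_pure[OF W Y d] cong: image_cong)
  have "pure Y \<one>\<^bsub>?B\<^esub> y \<in> (\<lambda>w. pure Y \<one>\<^bsub>?B\<^esub> (d w)) ` carrier W"
    if y: "y \<in> carrier Y" "red y = \<zero>\<^bsub>?R\<^esub>" for y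
  proof -
    have "r y \<in> ideal_smult I M"
      using y reduced_mod_eq_zero_iff[OF M I mod_hom_closed[OF r(1) y(1)]] by (simp add: red_def)
    then obtain z where z: "z \<in> ideal_smult I Y" "r z = r y"
      using ideal_smult_lift[OF Y M I r] by blast
    have zc: "z \<in> carrier Y"
      by (rule ideal_smult_subset[OF Y I z(1)])
    have "r (y \<ominus>\<^bsub>Y\<^esub> z) = \<zero>\<^bsub>M\<^esub>"
      using z(2) mod_hom_minus[OF r(1) Y.M.abelian_group_axioms M.M.abelian_group_axioms y(1) zc]
        abelian_group_minus_eq_zero_iff[OF M.M.abelian_group_axioms] mod_hom_closed[OF r(1)] y(1)
      by simp
    then obtain w where w: "w \<in> carrier W" "y \<ominus>\<^bsub>Y\<^esub> z = d w"
      using ker y(1) zc by blast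
    have dw: "d w \<in> carrier Y"
      by (rule mod_hom_closed[OF d w(1)])
    have "y = d w \<oplus>\<^bsub>Y\<^esub> z"
      using y(1) zc by (simp flip: w(2) add: Y.M.minus_eq Y.M.a_assoc Y.M.l_neg)
    then have "pure Y \<one>\<^bsub>?B\<^esub> y = pure Y \<one>\<^bsub>?B\<^esub> (d w)"
      using one_add[OF dw zc] pure_I[OF z(1)] pure_closed[OF B.one_closed dw] by simp
    then show ?thesis using w(1) by blast
  qed
  moreover have "red (d w) = \<zero>\<^bsub>?R\<^esub>" if "w \<in> carrier W" for w
  proof -
    have "r (d w) = \<zero>\<^bsub>M\<^esub>"
      using ker that by blast
    then show ?thesis
      using reduced_mod_eq_zero_iff[OF M I M.M.zero_closed]
        subgroup.one_closed[OF subgroup_ideal_smult[OF M I]] by (simp add: red_def)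
  qed
  ultimately have "{U \<in> carrier (ext Y). \<psi> U = \<zero>\<^bsub>?R\<^esub>} =
      tensor_map ?B ((+>\<^bsub>A\<^esub>) I) A Y d ` carrier (ext W)"
    unfolding image elem(1) using mod_hom_closed[OF d] by (auto simp: \<psi>_one)
  then show ?thesis
    using \<psi>_hom \<psi>_surj unfolding is_cokernel_def by blast
qed


section \<open>Two-term complexes\<close>

lemma ends_in_degree_0_silting:
  assumes "basic_two_term_silting K A T"
  shows "ends_in_degree_0 T" "dif T (-1) \<in> mod_hom A (obj T (-1)) (obj T 0)"
    "\<And>n. left_module A (obj T n)"
proof -
  have T: "is_complex A T" "two_term T"
    using assms by (auto simp: basic_two_term_silting_def silting_def bounded_proj_complex_def)
  show lm: "left_module A (obj T n)" for n
    using T(1) by (simp add: is_complex_def)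
  have d: "dif T n \<in> mod_hom A (obj T n) (obj T (n + 1))" for n
    using T(1) by (simp add: is_complex_def)
  show "dif T (-1) \<in> mod_hom A (obj T (-1)) (obj T 0)"
    using d[of "-1"] by simp
  show "ends_in_degree_0 T"
    using T(2) lm mod_hom_closed[OF d] left_module.axioms(2)[OF lm]
    unfolding ends_in_degree_0_def two_term_def by simp
qed

lemma ends_in_degree_0_ext:
  assumes T: "basic_two_term_silting K A T" and A: "ring A" and I: "ideal I A"
  shows "ends_in_degree_0 (tensor_cpx (quot_algebra A I) (\<lambda>a. I +>\<^bsub>A\<^esub> a) A T)"
proof -
  interpret scalar_extension A "quot_algebra A I" "(+>\<^bsub>A\<^esub>) I"
    by (rule scalar_extension_quot[OF A I])
  note T' = ends_in_degree_0_silting[OF T]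
  have elem: "carrier (ext (obj T n)) = pure (obj T n) \<one>\<^bsub>quot_algebra A I\<^esub> ` carrier (obj T n)" for n
    by (rule carrier_ext_surj[OF T'(3) quot_algebra_surj[symmetric]])
  have d: "dif T n \<in> mod_hom A (obj T n) (obj T (n + 1))" for n
    using T by (simp add: basic_two_term_silting_def silting_def bounded_proj_complex_def is_complex_def)
  have "tensor_map (quot_algebra A I) ((+>\<^bsub>A\<^esub>) I) A (obj T (n + 1)) (dif T n)
      \<in> carrier (ext (obj T n)) \<rightarrow> carrier (ext (obj T (n + 1)))" for n
    by (auto simp: elem tensor_map_pure[OF T'(3) T'(3) d] mod_hom_closed[OF d])
  moreover have "carrier (ext (obj T 1)) = {\<zero>\<^bsub>ext (obj T 1)\<^esub>}"
  proof -
    have "carrier (obj T 1) = {\<zero>\<^bsub>obj T 1\<^esub>}"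
      using T'(1) by (simp add: ends_in_degree_0_def is_zero_def)
    moreover have "\<zero>\<^bsub>ext (obj T 1)\<^esub> \<in> carrier (ext (obj T 1))"
      using abelian_group_ext[OF T'(3)] by (simp add: abelian_group_def abelian_monoid.zero_closed)
    ultimately show ?thesis by (auto simp: elem)
  qed
  ultimately show ?thesis
    using abelian_group_ext[OF T'(3)]
    by (simp add: ends_in_degree_0_def tensor_cpx_def is_zero_def)
qed

lemma two_term_complex_simps:
  "obj (two_term_complex Q g P) (-1) = Q" "obj (two_term_complex Q g P) 0 = P"
  "dif (two_term_complex Q g P) (-1) = g"
  by (simp_all add: two_term_complex_def fun_eq_iff)

lemma ends_in_degree_0_two_term_complex:
  fixes Q P :: "('a, 'v) module"
  assumes "abelian_group Q" "abelian_group P" "g \<in> mod_hom A Q P"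
  shows "ends_in_degree_0 (two_term_complex Q g P)"
proof -
  have "abelian_group (zero_mod :: ('a, 'v) module)"
    by (rule abelian_groupI) (simp_all add: zero_mod_def mk_mod_def)
  then have grp: "abelian_group (obj (two_term_complex Q g P) n)" for n
    using assms(1,2) by (simp add: two_term_complex_def Let_def)
  have "dif (two_term_complex Q g P) n x \<in> carrier (obj (two_term_complex Q g P) (n + 1))"
    if x: "x \<in> carrier (obj (two_term_complex Q g P) n)" for n x
  proof (cases "n = -1")
    case True
    with x show ?thesis
      using mod_hom_closed[OF assms(3)] by (simp add: two_term_complex_simps)
  next
    case False
    then have "dif (two_term_complex Q g P) n x = \<zero>\<^bsub>obj (two_term_complex Q g P) (n + 1)\<^esub>"
      by (simp add: two_term_complex_def Let_def)
    then show ?thesis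
      using grp[of "n + 1"] by (simp add: abelian_group_def abelian_monoid.zero_closed)
  qed
  moreover have "is_zero (obj (two_term_complex Q g P) 1)"
    by (simp add: two_term_complex_def is_zero_def zero_mod_def mk_mod_def)
  ultimately show ?thesis
    using grp by (simp add: ends_in_degree_0_def)
qed

lemma minimal_presentation_cokernel:
  assumes "minimal_presentation K A P1 f P0 p M" "e \<in> mod_iso A (mod_sum P1 P) Q"
    and "abelian_group P" "\<forall>x\<in>carrier P1. \<forall>y\<in>carrier P. g (e (x, y)) = f x"
  shows "is_cokernel A Q g P0 M p"
proof -
  have p: "p \<in> mod_hom A P0 M" "p ` carrier P0 = carrier M"
    and f: "f ` carrier P1 = a_kernel P0 M p"
    using assms(1) by (auto simp: minimal_presentation_def projective_cover_def)
  have "carrier Q = e ` (carrier P1 \<times> carrier P)"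
    using assms(2) by (auto simp: mod_iso_def bij_betw_def mod_sum_def mk_mod_def)
  then have "g ` carrier Q = (\<lambda>z. f (fst z)) ` (carrier P1 \<times> carrier P)"
    using assms(4) by (auto simp: image_image intro!: image_cong)
  also have "\<dots> = f ` fst ` (carrier P1 \<times> carrier P)"
    by (simp only: image_image)
  also have "fst ` (carrier P1 \<times> carrier P) = carrier P1"
    using assms(3) abelian_monoid.zero_closed[of P] by (auto simp: abelian_group_def)
  finally have "g ` carrier Q = f ` carrier P1" .
  then show ?thesis
    using p f by (simp add: is_cokernel_def a_kernel_def kernel_def)
qed

lemma isomorphic_K_refl:
  assumes "is_complex A U"
  shows "isomorphic_K A U U"
proof -
  have lm: "left_module A (obj U n)" and d: "dif U n \<in> mod_hom A (obj U n) (obj U (n + 1))" for n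
    using assms by (simp_all add: is_complex_def)
  have ab: "abelian_group (obj U n)" for n
    by (rule left_module.axioms(2)[OF lm])
  have z: "\<zero>\<^bsub>obj U n\<^esub> \<in> carrier (obj U n)" "x \<in> carrier (obj U n) \<Longrightarrow> x \<oplus>\<^bsub>obj U n\<^esub> \<zero>\<^bsub>obj U n\<^esub> = x" for n x
    using abelian_group.axioms(1)[OF ab] by (auto simp: abelian_monoid.zero_closed abelian_monoid.r_zero)
  have d0: "dif U (n - 1) \<zero>\<^bsub>obj U (n - 1)\<^esub> = \<zero>\<^bsub>obj U n\<^esub>" for n
    using mod_hom_zero[OF d[of "n - 1"] ab ab] by simp
  have "(\<lambda>n x. x) \<in> chain_maps A U U"
    by (simp add: chain_maps_def mod_hom_def)
  moreover have "homotopic_maps A U U (\<lambda>n x. x) (\<lambda>n x. x)"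
    unfolding homotopic_maps_def
    by (rule exI[of _ "\<lambda>n x. \<zero>\<^bsub>obj U (n - 1)\<^esub>"])
      (auto simp: mod_hom_def z d0 left_module.smult_r_null[OF lm])
  ultimately show ?thesis
    unfolding isomorphic_K_def by (intro bexI[of _ "\<lambda>n x. x"]) simp_all
qed

lemma stau_tilt_left_module:
  assumes "U \<in> stau_tilt K A" "M \<in> U"
  shows "left_module A M"
  using assms by (auto simp: stau_tilt_def iso_class_def fd_mod_def)

text \<open>Under the Adachi--Iyama--Reiten correspondence the module is the cokernel of the complex.\<close>

lemma air_corresponds_cokernel:
  fixes A :: "('k, 'a) module"
  assumes air: "air_corresponds K A U S" and T: "basic_two_term_silting K A T" "T \<in> S"
  shows "\<exists>M\<in>U. \<exists>r. is_cokernel A (obj T (-1)) (dif T (-1)) (obj T 0) M r"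
proof -
  obtain M P P1 f and P0 :: "('a, 'k list) module" and p Q e g
    where M: "M \<in> U" and P: "support_complement K A M P"
      and pres: "minimal_presentation K A P1 f P0 p M"
      and Q: "fd_mod K A Q" "e \<in> mod_iso A (mod_sum P1 P) Q" "g \<in> mod_hom A Q P0"
        "\<forall>x\<in>carrier P1. \<forall>y\<in>carrier P. g (e (x, y)) = f x"
      and S: "S = K_class K A (two_term_complex Q g P0)" and U: "U \<in> stau_tilt K A"
    using air unfolding air_corresponds_def by blast
  have lm: "left_module A P" "left_module A P0" "left_module A Q" "left_module A M"
    using P pres Q(1) stau_tilt_left_module[OF U M]
    by (auto simp: support_complement_def minimal_presentation_def projective_cover_def
        projective_mod_def fd_mod_def)
  note ab = lm[THEN left_module.axioms(2)]
  have "is_cokernel A Q g P0 M p"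
    by (rule minimal_presentation_cokernel[OF pres Q(2) ab(1) Q(4)])
  moreover have "isomorphic_K A (two_term_complex Q g P0) T"
    using T(2) by (simp add: S K_class_def)
  ultimately have "\<exists>r. is_cokernel A (obj T (-1)) (dif T (-1)) (obj T 0) M r"
    using is_cokernel_isomorphic_K[of A "two_term_complex Q g P0" T M p]
      ends_in_degree_0_two_term_complex[OF ab(3,2) Q(3)] ends_in_degree_0_silting[OF T(1)] ab(4)
    by (simp add: two_term_complex_simps)
  with M show ?thesis by blast
qed

lemma two_silt_representative:
  assumes "S \<in> two_silt K A"
  obtains T where "basic_two_term_silting K A T" "S = K_class K A T" "T \<in> S"
  using assms isomorphic_K_refl
  by (auto simp: two_silt_def K_class_def basic_two_term_silting_def silting_def
      bounded_proj_complex_def)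


section \<open>The reduction of support \<open>\<tau>\<close>-tilting modules\<close>

theorem corollary3p2:
  fixes K :: "'k ring"
    and \<Lambda> :: "('k, 'a) module"
    and I :: "'a set"
    and \<Phi> :: "('a, 'k list) module set \<Rightarrow> ('a set, 'k list) module set"
    and M :: "('a, 'k list) module"
  assumes "algebraically_closed K"
    and "fd_algebra K \<Lambda>"
    and "ideal I \<Lambda>"
    and "I \<subseteq> (center \<Lambda> \<inter> jacobson_radical \<Lambda>) \<cdot>\<^bsub>\<Lambda>\<^esub> carrier \<Lambda>"
    and "ejr_iso K \<Lambda> I \<Phi>"
    and "support_tau_tilting K \<Lambda> M" and "basic_mod K \<Lambda> M"
  shows "iso_class K (quot_algebra \<Lambda> I) (reduced_mod I M) \<in> stau_tilt K (quot_algebra \<Lambda> I) \<and>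
         \<Phi> (iso_class K \<Lambda> M) = iso_class K (quot_algebra \<Lambda> I) (reduced_mod I M)"
proof -
  let ?B = "quot_algebra \<Lambda> I" and ?q = "\<lambda>a. I +>\<^bsub>\<Lambda>\<^esub> a" and ?U = "iso_class K \<Lambda> M"
  have \<Lambda>: "ring \<Lambda>"
    using assms(2) by (simp add: fd_algebra_def)
  have M: "left_module \<Lambda> M"
    using assms(6) by (simp add: support_tau_tilting_def fd_mod_def)
  have R: "left_module ?B (reduced_mod I M)"
    by (rule left_module_reduced_mod[OF M assms(3)])
  note ab = left_module.axioms(2)
  have "?U \<in> stau_tilt K \<Lambda>"
    using assms(6,7) by (auto simp: stau_tilt_def)
  then obtain \<Psi> S where \<Psi>: "ejr_silting_iso K \<Lambda> I \<Psi>"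
    and S: "air_corresponds K \<Lambda> ?U S" and S': "air_corresponds K ?B (\<Phi> ?U) (\<Psi> S)"
    using assms(5) unfolding ejr_iso_def by blast
  have "S \<in> two_silt K \<Lambda>" "\<Psi> S \<in> two_silt K ?B"
    using S S' by (simp_all add: air_corresponds_def)
  then obtain T T' where T: "basic_two_term_silting K \<Lambda> T" "S = K_class K \<Lambda> T" "T \<in> S"
    and T': "basic_two_term_silting K ?B T'" "T' \<in> \<Psi> S"
    by (metis two_silt_representative)
  obtain M' r where M': "M' \<in> ?U"
    and r: "is_cokernel \<Lambda> (obj T (-1)) (dif T (-1)) (obj T 0) M' r"
    using air_corresponds_cokernel[OF S T(1,3)] by blast
  obtain s where s: "s \<in> mod_iso \<Lambda> M' M" and lmM': "left_module \<Lambda> M'"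
    using M' isomorphic_mod_sym[OF _ M, of M'] by (auto simp: iso_class_def isomorphic_mod_def fd_mod_def)
  have "is_cokernel \<Lambda> (obj T (-1)) (dif T (-1)) (obj T 0) M (\<lambda>y. s (r y))"
    by (rule is_cokernel_iso[OF r s ab[OF lmM'] ab[OF M]])
  then obtain t where
    "is_cokernel ?B (tensor_mod ?B ?q \<Lambda> (obj T (-1))) (tensor_map ?B ?q \<Lambda> (obj T 0) (dif T (-1)))
      (tensor_mod ?B ?q \<Lambda> (obj T 0)) (reduced_mod I M) t"
    using is_cokernel_ext[OF ends_in_degree_0_silting(3)[OF T(1)] ends_in_degree_0_silting(3)[OF T(1)]
        M assms(3) ends_in_degree_0_silting(2)[OF T(1)]] by blast
  moreover have "isomorphic_K ?B (tensor_cpx ?B ?q \<Lambda> T) T'"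
    using \<Psi> T T'(2) by (simp add: ejr_silting_iso_def K_class_def)
  ultimately obtain u where
    u: "is_cokernel ?B (obj T' (-1)) (dif T' (-1)) (obj T' 0) (reduced_mod I M) u"
    using is_cokernel_isomorphic_K[of ?B "tensor_cpx ?B ?q \<Lambda> T" T' "reduced_mod I M" t]
      ends_in_degree_0_ext[OF T(1) \<Lambda> assms(3)] ends_in_degree_0_silting[OF T'(1)] ab[OF R]
    by (auto simp: tensor_cpx_def)
  obtain N v where N: "N \<in> \<Phi> ?U" and v: "is_cokernel ?B (obj T' (-1)) (dif T' (-1)) (obj T' 0) N v"
    using air_corresponds_cokernel[OF S' T'] by blast
  have \<Phi>U: "\<Phi> ?U \<in> stau_tilt K ?B"
    using S' by (simp add: air_corresponds_def)
  have lmN: "left_module ?B N"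
    by (rule stau_tilt_left_module[OF \<Phi>U N])
  \<comment> \<open>\<open>N\<close> and \<open>M / I M\<close> are cokernels of the same map, the differential of \<open>T'\<close>.\<close>
  have iso: "isomorphic_mod ?B N (reduced_mod I M)" "isomorphic_mod ?B (reduced_mod I M) N"
    using is_cokernel_unique[OF ends_in_degree_0_silting(3)[OF T'(1)]] ab[OF R] ab[OF lmN] u v by blast+
  obtain N0 :: "('a set, 'k list) module" where N0: "\<Phi> ?U = iso_class K ?B N0" "left_module ?B N0"
    using \<Phi>U by (auto simp: stau_tilt_def support_tau_tilting_def fd_mod_def)
  have "N \<in> iso_class K ?B N0"
    using N N0(1) by simp
  then have "isomorphic_mod ?B N0 N"
    by (simp add: iso_class_def)
  then have N0R: "isomorphic_mod ?B N0 (reduced_mod I M)" "isomorphic_mod ?B (reduced_mod I M) N0"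
    using isomorphic_mod_trans[OF _ iso(1)] isomorphic_mod_trans[OF iso(2)]
      isomorphic_mod_sym[OF _ N0(2)] by auto
  have "iso_class K ?B N0 = iso_class K ?B (reduced_mod I M)"
    unfolding iso_class_def
    using isomorphic_mod_trans[OF N0R(1)] isomorphic_mod_trans[OF N0R(2)] by auto
  then show ?thesis
    using \<Phi>U N0(1) by simp
qed

end
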